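(* Let $\Omega\subseteq\mathbb C^d$ be an irreducible bounded symmetric domain and $\mathbb K$ the group of linear biholomorphic automorphisms of $\Omega$. Let $\mathcal H_K(\Omega,\mathbb C^n)$ be a reproducing kernel Hilbert space of holomorphic functions on $\Omega$ with values in $\mathbb C^n$ and reproducing kernel $K:\Omega\times\Omega\to\mathcal M_n(\mathbb C)$. Assume that $\mathbb C^n\otimes\mathcal P$ (the $\mathbb C^n$-valued polynomials) is densely contained in $\mathcal H_K(\Omega,\mathbb C^n)$, that the $d$-tuple $\boldsymbol M$ of multiplication by the coordinate functions on $\mathcal H_K(\Omega,\mathbb C^n)$ is bounded, and that $K$ is normalized at $0$, i.e. $K(\boldsymbol z,0)=I_n$ for all $\boldsymbol z\in\Omega$. Then the following are equivalent: (1) $\boldsymbol M$ is $\mathbb K$-homogeneous, i.e. for each $k\in\mathbb K$ there is a unitary $\Gamma(k)$ on $\mathcal H_K(\Omega,\mathbb C^n)$ with $\Gamma(k)(k\cdot\boldsymbol M)\Gamma(k)^*=\boldsymbol M$; (2) $K$ is quasi-invariant under $\mathbb K$ with a multiplier $c:\mathbb K\times\Omega\to\mathcal U(n)$ such that $c(k,\boldsymbol z)$ is independent of $\boldsymbol z$; (3) there is a map $c:\mathbb K\to\mathcal U(n)$ such that for each $k\in\mathbb K$ the operator $(\Gamma(k)f)(\boldsymbol z):=c(k)f(k^{-1}\cdot\boldsymbol z)$ is unitary on $\mathcal H_K(\Omega,\mathbb C^n)$.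
   Context: For $k\in\mathbb K$, $k\cdot\boldsymbol z=(k_1(\boldsymbol z),\ldots,k_d(\boldsymbol z))$ with $k_j$ linear, and $k\cdot\boldsymbol M=(k_1(\boldsymbol M),\ldots,k_d(\boldsymbol M))$. $K$ is quasi-invariant under $\mathbb K$ with multiplier $c$ if $K(\boldsymbol z,\boldsymbol w)=c(k,\boldsymbol z)K(k^{-1}\cdot\boldsymbol z,k^{-1}\cdot\boldsymbol w)c(k,\boldsymbol w)^*$ for all $k\in\mathbb K$, $\boldsymbol z,\boldsymbol w\in\Omega$. *)

theory Defs
  imports "HOL-Analysis.Analysis" "HOL-Library.Function_Algebras"
begin

section \<open>Several complex variables: holomorphic maps, domains\<close>

text \<open>Points of C^d are vectors of type complex^'d; complex scalar multiplication is *s.\<close>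

definition holo_on :: "(complex^'d) set \<Rightarrow> (complex^'d \<Rightarrow> complex^'m) \<Rightarrow> bool" where
  "holo_on S f \<longleftrightarrow> (\<forall>x\<in>S. \<exists>L. (f has_derivative L) (at x) \<and>
                         (\<forall>(c::complex) v. L (c *s v) = c *s L v))"

definition biholo :: "(complex^'d) set \<Rightarrow> (complex^'d) set \<Rightarrow> (complex^'d \<Rightarrow> complex^'d) \<Rightarrow> bool" where
  "biholo S T f \<longleftrightarrow> holo_on S f \<and> bij_betw f S T \<and> holo_on T (inv_into S f)"

definition bounded_domain :: "(complex^'d) set \<Rightarrow> bool" where
  "bounded_domain \<Omega> \<longleftrightarrow> open \<Omega> \<and> connected \<Omega> \<and> \<Omega> \<noteq> {} \<and> bounded \<Omega>"

text \<open>Bounded symmetric domain: every point is an isolated fixed point of an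
  involutive biholomorphic automorphism.\<close>
definition bounded_symmetric_domain :: "(complex^'d) set \<Rightarrow> bool" where
  "bounded_symmetric_domain \<Omega> \<longleftrightarrow> bounded_domain \<Omega> \<and>
     (\<forall>p\<in>\<Omega>. \<exists>s. biholo \<Omega> \<Omega> s \<and> (\<forall>z\<in>\<Omega>. s (s z) = z) \<and> s p = p \<and>
        (\<exists>e>0. \<forall>z\<in>\<Omega>. z \<noteq> p \<and> dist z p < e \<longrightarrow> s z \<noteq> z))"

text \<open>Coordinate projection onto the coordinates in I (others set to 0).\<close>
definition proj :: "'d set \<Rightarrow> complex^'d \<Rightarrow> complex^'d" where
  "proj I z = (\<chi> i. if i \<in> I then z$i else 0)"

text \<open>Irreducible: not biholomorphic to a (bounded) domain which is a product of two
  domains of positive dimension (living in complementary coordinate subspaces).\<close>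
definition irreducible_bsd :: "(complex^'d) set \<Rightarrow> bool" where
  "irreducible_bsd \<Omega> \<longleftrightarrow> bounded_symmetric_domain \<Omega> \<and>
     \<not> (\<exists>I D \<phi>. I \<noteq> {} \<and> I \<noteq> UNIV \<and> bounded_domain D \<and> biholo \<Omega> D \<phi> \<and>
            D = {z. proj I z \<in> proj I ` D \<and> proj (-I) z \<in> proj (-I) ` D})"

text \<open>The group of linear biholomorphic automorphisms, as matrices acting by *v.\<close>
definition lin_aut :: "(complex^'d) set \<Rightarrow> (complex^'d^'d) set" where
  "lin_aut \<Omega> = {A. biholo \<Omega> \<Omega> (\<lambda>z. A *v z)}"

section \<open>Matrices\<close>

definition cadj :: "complex^'n^'n \<Rightarrow> complex^'n^'n" where
  "cadj U = (\<chi> i j. cnj (U$j$i))"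

definition unitary_mat :: "complex^'n^'n \<Rightarrow> bool" where
  "unitary_mat U \<longleftrightarrow> U ** cadj U = mat 1 \<and> cadj U ** U = mat 1"

definition vinner :: "complex^'n \<Rightarrow> complex^'n \<Rightarrow> complex" where
  "vinner u v = (\<Sum>i\<in>UNIV. u$i * cnj (v$i))"

section \<open>Hilbert spaces of C^n-valued functions on \<Omega>\<close>

text \<open>A Hilbert space of functions is a set H of functions (vanishing outside \<Omega>)
  with an inner product ip (linear in the first argument).\<close>

definition hnorm :: "('a \<Rightarrow> 'a \<Rightarrow> complex) \<Rightarrow> 'a \<Rightarrow> real" where
  "hnorm ip f = sqrt (Re (ip f f))"

definition smult_fun :: "complex \<Rightarrow> ('x \<Rightarrow> complex^'n) \<Rightarrow> ('x \<Rightarrow> complex^'n)" where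
  "smult_fun c f = (\<lambda>z. c *s f z)"

definition kernel_fun :: "(complex^'d) set \<Rightarrow> (complex^'d \<Rightarrow> complex^'d \<Rightarrow> complex^'n^'n)
     \<Rightarrow> complex^'d \<Rightarrow> complex^'n \<Rightarrow> (complex^'d \<Rightarrow> complex^'n)" where
  "kernel_fun \<Omega> K w \<xi> = (\<lambda>z. if z \<in> \<Omega> then K z w *v \<xi> else 0)"

definition rkhs_holo ::
  "(complex^'d) set \<Rightarrow> (complex^'d \<Rightarrow> complex^'n) set
   \<Rightarrow> ((complex^'d \<Rightarrow> complex^'n) \<Rightarrow> (complex^'d \<Rightarrow> complex^'n) \<Rightarrow> complex)
   \<Rightarrow> (complex^'d \<Rightarrow> complex^'d \<Rightarrow> complex^'n^'n) \<Rightarrow> bool" where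
  "rkhs_holo \<Omega> H ip K \<longleftrightarrow>
     (\<forall>f\<in>H. holo_on \<Omega> f \<and> (\<forall>z. z \<notin> \<Omega> \<longrightarrow> f z = 0)) \<and>
     0 \<in> H \<and> (\<forall>f\<in>H. \<forall>g\<in>H. f + g \<in> H) \<and> (\<forall>c. \<forall>f\<in>H. smult_fun c f \<in> H) \<and>
     (\<forall>f\<in>H. \<forall>g\<in>H. \<forall>h\<in>H. ip (f + g) h = ip f h + ip g h) \<and>
     (\<forall>c. \<forall>f\<in>H. \<forall>g\<in>H. ip (smult_fun c f) g = c * ip f g) \<and>
     (\<forall>f\<in>H. \<forall>g\<in>H. ip g f = cnj (ip f g)) \<and>
     (\<forall>f\<in>H. Re (ip f f) \<ge> 0) \<and>
     (\<forall>f\<in>H. ip f f = 0 \<longrightarrow> f = 0) \<and>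
     (\<forall>s. (\<forall>n. s n \<in> H) \<and>
          (\<forall>e>0. \<exists>N. \<forall>m\<ge>N. \<forall>n\<ge>N. hnorm ip (s m - s n) < e) \<longrightarrow>
          (\<exists>f\<in>H. (\<lambda>n. hnorm ip (s n - f)) \<longlonglongrightarrow> 0)) \<and>
     (\<forall>w\<in>\<Omega>. \<forall>\<xi>. kernel_fun \<Omega> K w \<xi> \<in> H \<and>
          (\<forall>f\<in>H. ip f (kernel_fun \<Omega> K w \<xi>) = vinner (f w) \<xi>))"

section \<open>Polynomials\<close>

definition monomial :: "('d \<Rightarrow> nat) \<Rightarrow> complex^'d \<Rightarrow> complex" where
  "monomial \<alpha> z = (\<Prod>i\<in>UNIV. (z$i) ^ (\<alpha> i))"

text \<open>C^n-valued polynomials in d variables (elements of C^n \<otimes> P).\<close>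
definition vec_poly :: "(complex^'d \<Rightarrow> complex^'n) \<Rightarrow> bool" where
  "vec_poly p \<longleftrightarrow> (\<exists>A c. finite A \<and> (\<forall>z. p z = (\<Sum>\<alpha>\<in>A. monomial \<alpha> z *s c \<alpha>)))"

definition restrict_fun :: "(complex^'d) set \<Rightarrow> (complex^'d \<Rightarrow> complex^'n) \<Rightarrow> complex^'d \<Rightarrow> complex^'n" where
  "restrict_fun \<Omega> p = (\<lambda>z. if z \<in> \<Omega> then p z else 0)"

definition polys_dense :: "(complex^'d) set \<Rightarrow> (complex^'d \<Rightarrow> complex^'n) set
   \<Rightarrow> ((complex^'d \<Rightarrow> complex^'n) \<Rightarrow> (complex^'d \<Rightarrow> complex^'n) \<Rightarrow> complex) \<Rightarrow> bool" where
  "polys_dense \<Omega> H ip \<longleftrightarrow>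
     (\<forall>p. vec_poly p \<longrightarrow> restrict_fun \<Omega> p \<in> H) \<and>
     (\<forall>f\<in>H. \<forall>e>0. \<exists>p. vec_poly p \<and> hnorm ip (f - restrict_fun \<Omega> p) < e)"

section \<open>Operators\<close>

text \<open>Multiplication by the j-th coordinate function.\<close>
definition mult_op :: "'d \<Rightarrow> (complex^'d \<Rightarrow> complex^'n) \<Rightarrow> (complex^'d \<Rightarrow> complex^'n)" where
  "mult_op j f = (\<lambda>z. (z$j) *s f z)"

definition bounded_op_on where
  "bounded_op_on H ip T \<longleftrightarrow> (\<exists>C. \<forall>f\<in>H. T f \<in> H \<and> hnorm ip (T f) \<le> C * hnorm ip f)"

text \<open>k_j(M) = sum_i A_{ji} M_i, where k z = A z.\<close>
definition lin_mult_op :: "complex^'d^'d \<Rightarrow> 'd \<Rightarrow> (complex^'d \<Rightarrow> complex^'n) \<Rightarrow> (complex^'d \<Rightarrow> complex^'n)" where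
  "lin_mult_op A j f = (\<Sum>i\<in>UNIV. smult_fun (A$j$i) (mult_op i f))"

definition unitary_op where
  "unitary_op H ip T \<longleftrightarrow> T ` H = H \<and>
     (\<forall>f\<in>H. \<forall>g\<in>H. T (f + g) = T f + T g) \<and>
     (\<forall>c. \<forall>f\<in>H. T (smult_fun c f) = smult_fun c (T f)) \<and>
     (\<forall>f\<in>H. \<forall>g\<in>H. ip (T f) (T g) = ip f g)"

text \<open>Hilbert space adjoint of T on H.\<close>
definition hadj where
  "hadj H ip T g = (THE h. h \<in> H \<and> (\<forall>f\<in>H. ip (T f) g = ip f h))"

end

theory Submission
  imports Defs
begin

text \<open>
  For a linear automorphism \<open>k z = A z\<close> with inverse \<open>B\<close> and a unitary matrix \<open>u\<close>, the
  operator \<open>f \<mapsto> u f\<circ>B\<close> maps the kernel function \<open>K(\<cdot>, B w) \<eta>\<close> to \<open>K(\<cdot>, w) (u \<eta>)\<close> exactly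
  when \<open>K\<close> is quasi-invariant with the constant multiplier \<open>u\<close>. Hence (3) gives (2) by
  evaluating, and (2) gives (3) because the operator is then isometric on the span of the
  kernel functions, which is dense in any reproducing kernel Hilbert space (by the projection
  theorem), and its inverse has the same form. (3) gives (1) by a direct computation.

  For (1) \<open>\<Longrightarrow>\<close> (3), the adjoint \<open>\<Gamma>\<^sup>*\<close> intertwines \<open>M\<close> with \<open>k\<cdot>M\<close>, so it sends a monomial
  \<open>z\<^sup>\<alpha> \<xi>\<close> to \<open>(k z)\<^sup>\<alpha> (\<Gamma>\<^sup>* \<xi>)(z)\<close>. As \<open>K(\<cdot>, 0) = I\<close>, the constants are the kernel functions
  at \<open>0\<close>; testing against the dense polynomials shows that \<open>\<Gamma>\<close> and \<open>\<Gamma>\<^sup>*\<close> map constants to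
  constants through a matrix \<open>Q\<close>, so \<open>\<Gamma>\<^sup>* p = Q p\<circ>k\<close> for polynomials, \<open>\<Gamma> K(\<cdot>, w) \<eta> =
  K(\<cdot>, k w) (Q\<^sup>* \<eta>)\<close>, and finally \<open>\<Gamma>\<^sup>* f = Q f\<circ>k\<close> for all \<open>f\<close>; \<open>Q\<close> is unitary because
  \<open>\<Gamma>\<^sup>*\<close> is isometric on the constants.
\<close>

lemma sum_fun_apply: "(\<Sum>a\<in>A. f a) x = (\<Sum>a\<in>A. f a x)"
  by (induction A rule: infinite_finite_induct) auto

lemma diff_eq_add_smult_fun: "f - g = f + smult_fun (-1) g"
  by (auto simp: smult_fun_def fun_eq_iff vec_eq_iff)

lemma smult_fun_0 [simp]: "smult_fun 0 f = 0"
  by (auto simp: smult_fun_def fun_eq_iff)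

section \<open>Vectors and matrices\<close>

lemma cadj_cadj [simp]: "cadj (cadj U) = U"
  unfolding cadj_def by (simp add: vec_eq_iff)

lemma unitary_mat_cadj: "unitary_mat U \<Longrightarrow> unitary_mat (cadj U)"
  unfolding unitary_mat_def by simp

lemma unitary_matI: "cadj U ** U = mat 1 \<Longrightarrow> unitary_mat U"
  unfolding unitary_mat_def using matrix_left_right_inverse by blast

lemma vinner_axis: "vinner x (axis i 1) = x $ i"
  unfolding vinner_def axis_def by (simp add: if_distrib cong: if_cong)

lemma vinner_eqI: "(\<And>\<eta>. vinner x \<eta> = vinner y \<eta>) \<Longrightarrow> x = y"
  by (metis vinner_axis vec_eq_iff)

lemma vinner_0_left [simp]: "vinner 0 y = 0"
  unfolding vinner_def by simp

lemma vinner_matrix_vector_left: "vinner (M *v x) y = vinner x (cadj M *v y)"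
proof -
  have "vinner (M *v x) y = (\<Sum>i\<in>UNIV. \<Sum>j\<in>UNIV. M$i$j * x$j * cnj (y$i))"
    unfolding vinner_def matrix_vector_mult_def by (simp add: sum_distrib_right)
  also have "\<dots> = (\<Sum>j\<in>UNIV. \<Sum>i\<in>UNIV. M$i$j * x$j * cnj (y$i))"
    by (rule sum.swap)
  also have "\<dots> = vinner x (cadj M *v y)"
    unfolding vinner_def matrix_vector_mult_def cadj_def
    by (simp add: sum_distrib_left mult_ac)
  finally show ?thesis .
qed

lemma vinner_isometry: "cadj U ** U = mat 1 \<Longrightarrow> vinner (U *v x) (U *v y) = vinner x y"
  by (simp add: vinner_matrix_vector_left matrix_vector_mul_assoc)

lemma monomial_0 [simp]: "monomial (\<lambda>_. 0) z = 1"
  unfolding monomial_def by simp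

lemma monomial_remove_factor:
  assumes "\<alpha> j > 0"
  shows "monomial \<alpha> z = z $ j * monomial (\<alpha>(j := \<alpha> j - 1)) z"
proof -
  obtain k where k: "\<alpha> j = Suc k" using assms gr0_implies_Suc by blast
  have "monomial \<alpha> z = (z$j) ^ \<alpha> j * (\<Prod>i\<in>UNIV - {j}. (z$i) ^ \<alpha> i)"
    unfolding monomial_def by (rule prod.remove) simp_all
  moreover have "monomial (\<alpha>(j := k)) z = (z$j) ^ k * (\<Prod>i\<in>UNIV - {j}. (z$i) ^ (\<alpha>(j := k)) i)"
    unfolding monomial_def using prod.remove[of UNIV j "\<lambda>i. (z$i) ^ (\<alpha>(j := k)) i"] by simp
  moreover have "(\<Prod>i\<in>UNIV - {j}. (z$i) ^ (\<alpha>(j := k)) i) = (\<Prod>i\<in>UNIV - {j}. (z$i) ^ \<alpha> i)"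
    by (rule prod.cong) auto
  ultimately show ?thesis using k by simp
qed

lemma mult_op_apply: "mult_op j f z = z $ j *s f z"
  unfolding mult_op_def by simp

lemma lin_mult_op_apply: "lin_mult_op A j f z = (A *v z) $ j *s f z"
  unfolding lin_mult_op_def smult_fun_def mult_op_def sum_fun_apply
  by (simp add: vec_eq_iff matrix_vector_mult_def sum_distrib_right sum_distrib_left mult_ac)

section \<open>Linear automorphisms\<close>

lemma inj_matrix_vector_if_inj_on_open:
  fixes A :: "complex^'n^'m"
  assumes inj: "inj_on ((*v) A) \<Omega>" and "open \<Omega>" and "\<Omega> \<noteq> {}"
  shows "inj ((*v) A)"
proof (rule ccontr)
  assume "\<not> inj ((*v) A)"
  then obtain v where v: "v \<noteq> 0" "A *v v = 0"
    using vec.linear_inj_iff_eq_0[OF matrix_vector_mul_linear_gen] by blast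
  obtain p e where p: "p \<in> \<Omega>" and e: "e > 0" "ball p e \<subseteq> \<Omega>"
    using assms(2,3) open_contains_ball by blast
  define q where "q = p + (e / (2 * norm v)) *\<^sub>R v"
  have "dist p q = norm ((e / (2 * norm v)) *\<^sub>R v)"
    unfolding q_def dist_norm by (simp add: norm_minus_commute)
  also have "\<dots> < e"
    using v(1) e(1) by simp
  finally have q: "q \<in> \<Omega>" using e(2) by auto
  have "A *v (r *\<^sub>R v) = r *\<^sub>R (A *v v)" for r :: real
    by (simp add: vec_eq_iff matrix_vector_mult_def scaleR_sum_right)
  then have "A *v q = A *v p"
    by (simp add: q_def matrix_vector_right_distrib v(2))
  then have "q = p" using inj p q by (simp add: inj_on_def)
  then have "(e / (2 * norm v)) *\<^sub>R v = 0" unfolding q_def by simp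
  then show False using v(1) e(1) by simp
qed

lemma lin_aut_inverse:
  assumes A: "A \<in> lin_aut \<Omega>" and "open \<Omega>" and "\<Omega> \<noteq> {}"
  shows "A ** matrix_inv A = mat 1" and "matrix_inv A ** A = mat 1"
    and "A *v z \<in> \<Omega> \<longleftrightarrow> z \<in> \<Omega>" and "matrix_inv A *v z \<in> \<Omega> \<longleftrightarrow> z \<in> \<Omega>"
proof -
  have bij: "bij_betw ((*v) A) \<Omega> \<Omega>" using A unfolding lin_aut_def biholo_def by simp
  have inj: "inj ((*v) A)"
    using bij_betw_imp_inj_on[OF bij] assms(2,3) by (rule inj_matrix_vector_if_inj_on_open)
  then obtain B where BA: "B ** A = mat 1" using matrix_left_invertible_injective by blast
  moreover from BA have "A ** B = mat 1" by (rule matrix_left_right_inverse[THEN iffD2])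
  ultimately have "A ** matrix_inv A = mat 1 \<and> matrix_inv A ** A = mat 1"
    unfolding matrix_inv_def by (metis (mono_tags, lifting) someI)
  then show AB: "A ** matrix_inv A = mat 1" and "matrix_inv A ** A = mat 1" by auto
  have im: "(*v) A ` \<Omega> = \<Omega>" using bij by (simp add: bij_betw_def)
  show A_iff: "A *v z \<in> \<Omega> \<longleftrightarrow> z \<in> \<Omega>" for z
  proof
    assume "A *v z \<in> \<Omega>"
    then obtain y where "y \<in> \<Omega>" "A *v z = A *v y" using im by auto
    then show "z \<in> \<Omega>" using injD[OF inj] by metis
  qed (use im in blast)
  have "A *v (matrix_inv A *v z) = z" using AB by (simp add: matrix_vector_mul_assoc)
  then show "matrix_inv A *v z \<in> \<Omega> \<longleftrightarrow> z \<in> \<Omega>"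
    using A_iff[of "matrix_inv A *v z"] by simp
qed

section \<open>Reproducing kernel Hilbert spaces\<close>

definition hcauchy :: "('a \<Rightarrow> 'a \<Rightarrow> complex) \<Rightarrow> (nat \<Rightarrow> 'a::minus) \<Rightarrow> bool" where
  "hcauchy ip s \<longleftrightarrow> (\<forall>e>0. \<exists>N. \<forall>m\<ge>N. \<forall>n\<ge>N. hnorm ip (s m - s n) < e)"

locale rkhs_space =
  fixes \<Omega> :: "(complex^'d) set"
    and H :: "(complex^'d \<Rightarrow> complex^'n) set"
    and ip :: "(complex^'d \<Rightarrow> complex^'n) \<Rightarrow> (complex^'d \<Rightarrow> complex^'n) \<Rightarrow> complex"
    and K :: "complex^'d \<Rightarrow> complex^'d \<Rightarrow> complex^'n^'n"
  assumes rkhs: "rkhs_holo \<Omega> H ip K"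
begin

lemma rkhs_holo_fields:
  shows "\<forall>f\<in>H. holo_on \<Omega> f \<and> (\<forall>z. z \<notin> \<Omega> \<longrightarrow> f z = 0)"
    and "0 \<in> H" and "\<forall>f\<in>H. \<forall>g\<in>H. f + g \<in> H" and "\<forall>c. \<forall>f\<in>H. smult_fun c f \<in> H"
    and "\<forall>f\<in>H. \<forall>g\<in>H. \<forall>h\<in>H. ip (f + g) h = ip f h + ip g h"
    and "\<forall>c. \<forall>f\<in>H. \<forall>g\<in>H. ip (smult_fun c f) g = c * ip f g"
    and "\<forall>f\<in>H. \<forall>g\<in>H. ip g f = cnj (ip f g)"
    and "\<forall>f\<in>H. Re (ip f f) \<ge> 0"
    and "\<forall>f\<in>H. ip f f = 0 \<longrightarrow> f = 0"
    and "\<forall>s. (\<forall>n. s n \<in> H) \<and>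
          (\<forall>e>0. \<exists>N. \<forall>m\<ge>N. \<forall>n\<ge>N. hnorm ip (s m - s n) < e) \<longrightarrow>
          (\<exists>f\<in>H. (\<lambda>n. hnorm ip (s n - f)) \<longlonglongrightarrow> 0)"
    and "\<forall>w\<in>\<Omega>. \<forall>\<xi>. kernel_fun \<Omega> K w \<xi> \<in> H \<and>
          (\<forall>f\<in>H. ip f (kernel_fun \<Omega> K w \<xi>) = vinner (f w) \<xi>)"
  by (insert rkhs[unfolded rkhs_holo_def], (elim conjE, assumption)+)

lemma vanish_outside: "f \<in> H \<Longrightarrow> z \<notin> \<Omega> \<Longrightarrow> f z = 0"
  using rkhs_holo_fields(1) by blast

lemma zero_mem [simp]: "0 \<in> H"
  using rkhs_holo_fields(2) by blast

lemma add_mem [simp]: "f \<in> H \<Longrightarrow> g \<in> H \<Longrightarrow> f + g \<in> H"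
  using rkhs_holo_fields(3) by blast

lemma smult_mem [simp]: "f \<in> H \<Longrightarrow> smult_fun c f \<in> H"
  using rkhs_holo_fields(4) by blast

lemma diff_mem [simp]: "f \<in> H \<Longrightarrow> g \<in> H \<Longrightarrow> f - g \<in> H"
  by (simp add: diff_eq_add_smult_fun)

lemma sum_mem: "\<forall>i\<in>I. F i \<in> H \<Longrightarrow> sum F I \<in> H"
proof (induction I rule: infinite_finite_induct)
  case (insert i I)
  then have "F i + sum F I \<in> H" by (blast intro: add_mem)
  moreover have "sum F (insert i I) = F i + sum F I" using insert(1,2) by (rule sum.insert)
  ultimately show ?case by (simp only:)
qed (simp_all only: sum.infinite sum.empty not_False_eq_True zero_mem)

lemma kernel_mem [simp]: "w \<in> \<Omega> \<Longrightarrow> kernel_fun \<Omega> K w \<xi> \<in> H"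
  using rkhs_holo_fields(11) by blast

lemma reproducing: "w \<in> \<Omega> \<Longrightarrow> f \<in> H \<Longrightarrow> ip f (kernel_fun \<Omega> K w \<xi>) = vinner (f w) \<xi>"
  using rkhs_holo_fields(11) by blast

lemma ip_add_left: "f \<in> H \<Longrightarrow> g \<in> H \<Longrightarrow> h \<in> H \<Longrightarrow> ip (f + g) h = ip f h + ip g h"
  using rkhs_holo_fields(5) by blast

lemma ip_smult_left: "f \<in> H \<Longrightarrow> g \<in> H \<Longrightarrow> ip (smult_fun c f) g = c * ip f g"
  using rkhs_holo_fields(6) by blast

lemma ip_cnj: "f \<in> H \<Longrightarrow> g \<in> H \<Longrightarrow> ip g f = cnj (ip f g)"
  using rkhs_holo_fields(7) by blast

lemma ip_self_Re_nonneg: "f \<in> H \<Longrightarrow> 0 \<le> Re (ip f f)"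
  using rkhs_holo_fields(8) by blast

lemma ip_self_eq_0: "f \<in> H \<Longrightarrow> ip f f = 0 \<Longrightarrow> f = 0"
  using rkhs_holo_fields(9) by blast

lemma complete:
  assumes "\<And>n. s n \<in> H" and "hcauchy ip s"
  shows "\<exists>f\<in>H. (\<lambda>n. hnorm ip (s n - f)) \<longlonglongrightarrow> 0"
  using rkhs_holo_fields(10) assms unfolding hcauchy_def by blast

lemma ip_0_left [simp]: "f \<in> H \<Longrightarrow> ip 0 f = 0"
  using ip_smult_left[of 0 f 0] by simp

lemma ip_0_right [simp]: "f \<in> H \<Longrightarrow> ip f 0 = 0"
  using ip_cnj[of f 0] by simp

lemma ip_add_right: "f \<in> H \<Longrightarrow> g \<in> H \<Longrightarrow> h \<in> H \<Longrightarrow> ip h (f + g) = ip h f + ip h g"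
  using ip_cnj[of "f + g" h] ip_cnj[of f h] ip_cnj[of g h] ip_add_left[of f g h] by simp

lemma ip_smult_right: "f \<in> H \<Longrightarrow> g \<in> H \<Longrightarrow> ip g (smult_fun c f) = cnj c * ip g f"
  using ip_cnj[of "smult_fun c f" g] ip_cnj[of f g] ip_smult_left[of f g c] by simp

lemma ip_diff_left: "f \<in> H \<Longrightarrow> g \<in> H \<Longrightarrow> h \<in> H \<Longrightarrow> ip (f - g) h = ip f h - ip g h"
  by (simp add: diff_eq_add_smult_fun ip_add_left ip_smult_left)

lemma ip_diff_right: "f \<in> H \<Longrightarrow> g \<in> H \<Longrightarrow> h \<in> H \<Longrightarrow> ip h (f - g) = ip h f - ip h g"
  by (simp add: diff_eq_add_smult_fun ip_add_right ip_smult_right)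

lemma ip_self_real: "f \<in> H \<Longrightarrow> ip f f = complex_of_real (Re (ip f f))"
  using ip_cnj[of f f] by (simp add: complex_eq_iff)

lemma ip_self_Re_eq_0: "f \<in> H \<Longrightarrow> Re (ip f f) = 0 \<Longrightarrow> f = 0"
  using ip_self_real ip_self_eq_0 by fastforce

lemma ip_self_smult: "f \<in> H \<Longrightarrow> Re (ip (smult_fun c f) (smult_fun c f)) = (cmod c)^2 * Re (ip f f)"
proof -
  assume f: "f \<in> H"
  have "ip (smult_fun c f) (smult_fun c f) = (c * cnj c) * ip f f"
    using f by (simp add: ip_smult_left ip_smult_right)
  also have "\<dots> = complex_of_real ((cmod c)^2) * complex_of_real (Re (ip f f))"
    using ip_self_real[OF f] complex_norm_square[of c] by simp
  finally show ?thesis by simp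
qed

lemma eq_if_ip_eq:
  assumes "f \<in> H" and "g \<in> H" and "\<And>h. h \<in> H \<Longrightarrow> ip h f = ip h g"
  shows "f = g"
proof -
  have "ip (f - g) (f - g) = 0"
    using assms by (simp add: ip_diff_right)
  then have "f - g = 0" using ip_self_eq_0[of "f - g"] assms(1,2) by simp
  then show ?thesis by simp
qed

lemma eq_0_if_orthogonal_kernels:
  assumes f: "f \<in> H" and orth: "\<And>w \<eta>. w \<in> \<Omega> \<Longrightarrow> ip f (kernel_fun \<Omega> K w \<eta>) = 0"
  shows "f = 0"
proof
  fix z
  show "f z = 0 z"
  proof (cases "z \<in> \<Omega>")
    case True
    then show ?thesis using orth[OF True] reproducing[OF True f] by (auto intro: vinner_eqI)
  qed (simp add: vanish_outside f)
qed

lemma eq_0_if_orthogonal_polys: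
  assumes dense: "polys_dense \<Omega> H ip" and f: "f \<in> H"
    and orth: "\<And>p. vec_poly p \<Longrightarrow> ip f (restrict_fun \<Omega> p) = 0"
  shows "f = 0"
proof (rule ccontr)
  assume "f \<noteq> 0"
  then have "Re (ip f f) > 0"
    using ip_self_Re_nonneg[OF f] ip_self_Re_eq_0[OF f] by force
  then obtain p where p: "vec_poly p" and close: "hnorm ip (f - restrict_fun \<Omega> p) < sqrt (Re (ip f f))"
    using dense f unfolding polys_dense_def by (meson real_sqrt_gt_zero)
  define q where "q = restrict_fun \<Omega> p"
  have q: "q \<in> H" using dense p unfolding polys_dense_def q_def by blast
  have "ip f q = 0" "ip q f = 0"
    using orth[OF p] ip_cnj[OF f q] unfolding q_def by simp_all
  then have "ip (f - q) (f - q) = ip f f + ip q q"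
    using f q by (simp add: ip_diff_left ip_diff_right)
  then have "sqrt (Re (ip f f)) \<le> hnorm ip (f - q)"
    using ip_self_Re_nonneg[OF q] unfolding hnorm_def by simp
  then show False using close unfolding q_def by simp
qed

lemma ip_self_diff_projection:
  assumes f: "f \<in> H" and g: "g \<in> H" and g0: "Re (ip g g) \<noteq> 0"
  defines "t \<equiv> ip f g / ip g g"
  shows "Re (ip (f - smult_fun t g) (f - smult_fun t g))
        = Re (ip f f) - (cmod (ip f g))^2 / Re (ip g g)"
proof -
  define a r where "a = ip f g" and "r = Re (ip g g)"
  have gg: "ip g g = complex_of_real r" using ip_self_real[OF g] r_def by simp
  have gf: "ip g f = cnj a" using ip_cnj[OF f g] a_def by simp
  have tg: "smult_fun t g \<in> H" using g by simp
  have "ip (f - smult_fun t g) (f - smult_fun t g)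
      = ip f f - cnj t * a - t * cnj a + t * cnj t * complex_of_real r"
    using f g tg gf gg a_def
    by (simp add: ip_diff_left ip_diff_right ip_smult_left ip_smult_right algebra_simps)
  also have "\<dots> = ip f f - complex_of_real ((cmod a)^2 / r)"
  proof -
    have "a * cnj a = complex_of_real ((cmod a)^2)" using complex_norm_square[of a] by simp
    then show ?thesis
      using g0 unfolding t_def a_def[symmetric] gg r_def[symmetric] by (simp add: field_simps)
  qed
  finally show ?thesis unfolding a_def r_def by simp
qed

lemma cauchy_schwarz:
  assumes f: "f \<in> H" and g: "g \<in> H"
  shows "cmod (ip f g) \<le> hnorm ip f * hnorm ip g"
proof (cases "Re (ip g g) = 0")
  case True
  then show ?thesis using ip_self_Re_eq_0[OF g] f by (simp add: hnorm_def)
next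
  case False
  then have pos: "Re (ip g g) > 0" using ip_self_Re_nonneg[OF g] by linarith
  have "0 \<le> Re (ip (f - smult_fun (ip f g / ip g g) g) (f - smult_fun (ip f g / ip g g) g))"
    using f g by (simp add: ip_self_Re_nonneg)
  then have "(cmod (ip f g))^2 \<le> Re (ip f f) * Re (ip g g)"
    using ip_self_diff_projection[OF f g False] pos by (simp add: divide_le_eq)
  also have "\<dots> = (hnorm ip f * hnorm ip g)^2"
    using f g by (simp add: hnorm_def power_mult_distrib ip_self_Re_nonneg)
  finally show ?thesis
    by (rule power2_le_imp_le) (simp add: hnorm_def f g ip_self_Re_nonneg)
qed

lemma ip_tendsto_left:
  assumes "\<And>n. s n \<in> H" and "f \<in> H" and "k \<in> H"
    and lim: "(\<lambda>n. hnorm ip (s n - f)) \<longlonglongrightarrow> 0"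
  shows "(\<lambda>n. ip (s n) k) \<longlonglongrightarrow> ip f k"
proof -
  have "(\<lambda>n. ip (s n) k - ip f k) \<longlonglongrightarrow> 0"
  proof (rule Lim_null_comparison)
    show "\<forall>\<^sub>F n in sequentially. norm (ip (s n) k - ip f k) \<le> hnorm ip (s n - f) * hnorm ip k"
      using cauchy_schwarz[of "s n - f" k for n] assms(1-3) by (simp add: ip_diff_left)
    show "(\<lambda>n. hnorm ip (s n - f) * hnorm ip k) \<longlonglongrightarrow> 0"
      using tendsto_mult_left_zero[OF lim] .
  qed
  then show ?thesis by (rule LIM_zero_cancel)
qed

lemma ip_tendsto_right:
  assumes "\<And>n. s n \<in> H" and "f \<in> H" and "k \<in> H"
    and "(\<lambda>n. hnorm ip (s n - f)) \<longlonglongrightarrow> 0"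
  shows "(\<lambda>n. ip k (s n)) \<longlonglongrightarrow> ip k f"
  using tendsto_cnj[OF ip_tendsto_left[OF assms]] assms(1-3) by (simp add: ip_cnj[of _ k])

lemma parallelogram:
  assumes "f \<in> H" and "g \<in> H"
  shows "Re (ip (f - g) (f - g)) + Re (ip (f + g) (f + g)) = 2 * Re (ip f f) + 2 * Re (ip g g)"
  using assms by (simp add: ip_diff_left ip_diff_right ip_add_left ip_add_right)

subsection \<open>Unitary operators and their adjoints\<close>

lemma unitary_op_mem: "unitary_op H ip T \<Longrightarrow> f \<in> H \<Longrightarrow> T f \<in> H"
  unfolding unitary_op_def by blast

lemma unitary_op_surj: "unitary_op H ip T \<Longrightarrow> g \<in> H \<Longrightarrow> \<exists>f\<in>H. T f = g"
  unfolding unitary_op_def by (metis imageE)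

lemma unitary_op_ip: "unitary_op H ip T \<Longrightarrow> f \<in> H \<Longrightarrow> g \<in> H \<Longrightarrow> ip (T f) (T g) = ip f g"
  unfolding unitary_op_def by blast

lemma unitary_op_add: "unitary_op H ip T \<Longrightarrow> f \<in> H \<Longrightarrow> g \<in> H \<Longrightarrow> T (f + g) = T f + T g"
  unfolding unitary_op_def by blast

lemma unitary_op_smult: "unitary_op H ip T \<Longrightarrow> f \<in> H \<Longrightarrow> T (smult_fun c f) = smult_fun c (T f)"
  unfolding unitary_op_def by blast

lemma unitary_op_0: "unitary_op H ip T \<Longrightarrow> T 0 = 0"
  using unitary_op_smult[of T 0 0] by simp

lemma unitary_op_cong:
  assumes "unitary_op H ip T" and "\<And>f. f \<in> H \<Longrightarrow> T' f = T f"
  shows "unitary_op H ip T'"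
proof -
  have "T' ` H = T ` H" using assms(2) by (rule image_cong[OF refl])
  then show ?thesis using assms unfolding unitary_op_def by simp
qed

lemma hadj_unitary_op:
  assumes T: "unitary_op H ip T" and f: "f \<in> H"
  shows "hadj H ip T (T f) = f"
  unfolding hadj_def
proof (rule the_equality)
  show "f \<in> H \<and> (\<forall>h\<in>H. ip (T h) (T f) = ip h f)"
    using f unitary_op_ip[OF T] by blast
  fix f' assume "f' \<in> H \<and> (\<forall>h\<in>H. ip (T h) (T f) = ip h f')"
  then show "f' = f"
    using f unitary_op_ip[OF T _ f] by (intro eq_if_ip_eq) auto
qed

lemma hadj_mem: "unitary_op H ip T \<Longrightarrow> g \<in> H \<Longrightarrow> hadj H ip T g \<in> H"
  using unitary_op_surj hadj_unitary_op by metis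

lemma unitary_op_hadj: "unitary_op H ip T \<Longrightarrow> g \<in> H \<Longrightarrow> T (hadj H ip T g) = g"
  using unitary_op_surj hadj_unitary_op by metis

lemma ip_hadj_left:
  "unitary_op H ip T \<Longrightarrow> g \<in> H \<Longrightarrow> k \<in> H \<Longrightarrow> ip (hadj H ip T g) k = ip g (T k)"
  using unitary_op_ip[of T "hadj H ip T g" k] by (simp add: hadj_mem unitary_op_hadj)

lemma ip_hadj_right:
  "unitary_op H ip T \<Longrightarrow> f \<in> H \<Longrightarrow> g \<in> H \<Longrightarrow> ip (T f) g = ip f (hadj H ip T g)"
  using unitary_op_ip[of T f "hadj H ip T g"] by (simp add: hadj_mem unitary_op_hadj)

lemma hadj_ip:
  "unitary_op H ip T \<Longrightarrow> f \<in> H \<Longrightarrow> g \<in> H \<Longrightarrow> ip (hadj H ip T f) (hadj H ip T g) = ip f g"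
  using ip_hadj_left[of T f "hadj H ip T g"] by (simp add: hadj_mem unitary_op_hadj)

lemma hadj_add:
  assumes T: "unitary_op H ip T" and "f \<in> H" "g \<in> H"
  shows "hadj H ip T (f + g) = hadj H ip T f + hadj H ip T g"
proof -
  have "T (hadj H ip T f + hadj H ip T g) = f + g"
    using assms by (simp add: unitary_op_add[OF T] hadj_mem[OF T] unitary_op_hadj[OF T])
  then show ?thesis using hadj_unitary_op[OF T] assms by (metis add_mem hadj_mem)
qed

lemma hadj_smult:
  assumes T: "unitary_op H ip T" and "f \<in> H"
  shows "hadj H ip T (smult_fun c f) = smult_fun c (hadj H ip T f)"
proof -
  have "T (smult_fun c (hadj H ip T f)) = smult_fun c f"
    using assms by (simp add: unitary_op_smult[OF T] hadj_mem[OF T] unitary_op_hadj[OF T])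
  then show ?thesis using hadj_unitary_op[OF T] assms by (metis smult_mem hadj_mem)
qed

lemma hadj_0: "unitary_op H ip T \<Longrightarrow> hadj H ip T 0 = 0"
  using hadj_unitary_op[of T 0] unitary_op_0[of T] by simp

lemma hadj_sum:
  assumes T: "unitary_op H ip T"
  shows "\<forall>i\<in>I. F i \<in> H \<Longrightarrow> hadj H ip T (sum F I) = (\<Sum>i\<in>I. hadj H ip T (F i))"
proof (induction I rule: infinite_finite_induct)
  case (insert i I)
  then have F: "F i \<in> H" "sum F I \<in> H" and IH: "hadj H ip T (sum F I) = (\<Sum>i\<in>I. hadj H ip T (F i))"
    by (auto intro: sum_mem)
  have "hadj H ip T (sum F (insert i I)) = hadj H ip T (F i) + hadj H ip T (sum F I)"
    unfolding sum.insert[OF insert(1,2)] using F by (rule hadj_add[OF T])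
  then show ?case unfolding IH sum.insert[OF insert(1,2)] .
qed (simp_all add: hadj_0[OF T])

subsection \<open>Density of the span of the kernel functions\<close>

inductive_set kernel_span :: "(complex^'d \<Rightarrow> complex^'n) set" where
  zero: "0 \<in> kernel_span"
| kernel: "w \<in> \<Omega> \<Longrightarrow> kernel_fun \<Omega> K w \<xi> \<in> kernel_span"
| add: "s \<in> kernel_span \<Longrightarrow> t \<in> kernel_span \<Longrightarrow> s + t \<in> kernel_span"
| smult: "s \<in> kernel_span \<Longrightarrow> smult_fun c s \<in> kernel_span"

lemma kernel_span_subset: "kernel_span \<subseteq> H"
proof
  show "s \<in> H" if "s \<in> kernel_span" for s
    using that
    by (induction rule: kernel_span.induct) (rule zero_mem add_mem smult_mem kernel_mem; assumption)+
qed

lemma hcauchy_if_sq_dist_le: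
  assumes "\<And>n. s n \<in> H"
    and le: "\<And>m n. Re (ip (s m - s n) (s m - s n)) \<le> 2 / (real n + 1) + 2 / (real m + 1)"
  shows "hcauchy ip s"
  unfolding hcauchy_def
proof (intro allI impI)
  fix e :: real assume e: "e > 0"
  obtain N :: nat where N: "4 / e^2 < real N" using reals_Archimedean2 by blast
  then have "4 / (real N + 1) < e^2"
    using e by (simp add: field_simps) (smt (verit) mult_nonneg_nonneg of_nat_0_le_iff zero_le_power2)
  show "\<exists>N. \<forall>m\<ge>N. \<forall>n\<ge>N. hnorm ip (s m - s n) < e"
  proof (intro exI[of _ N] allI impI)
    fix m n assume "m \<ge> N" "n \<ge> N"
    then have "2 / (real n + 1) \<le> 2 / (real N + 1)" "2 / (real m + 1) \<le> 2 / (real N + 1)"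
      by (simp_all add: frac_le)
    then have "Re (ip (s m - s n) (s m - s n)) < e^2"
      using le[of m n] \<open>4 / (real N + 1) < e^2\<close> by linarith
    then have "sqrt (Re (ip (s m - s n) (s m - s n))) < sqrt (e^2)"
      by (rule real_sqrt_less_mono)
    then show "hnorm ip (s m - s n) < e" using e by (simp add: hnorm_def)
  qed
qed

text \<open>In the next two lemmas \<open>\<delta>\<close> is the squared distance from \<open>f\<close> to the subspace \<open>S\<close>,
  and \<open>s\<close> is a minimizing sequence.\<close>

lemma minimizing_sequence_hcauchy:
  assumes S: "S \<subseteq> H" "\<And>s t. s \<in> S \<Longrightarrow> t \<in> S \<Longrightarrow> s + t \<in> S" "\<And>c s. s \<in> S \<Longrightarrow> smult_fun c s \<in> S"
    and f: "f \<in> H" and s: "\<And>n. s n \<in> S"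
    and inf: "\<And>t. t \<in> S \<Longrightarrow> \<delta> \<le> Re (ip (f - t) (f - t))"
    and approx: "\<And>n. Re (ip (f - s n) (f - s n)) < \<delta> + 1 / (real n + 1)"
  shows "hcauchy ip s"
proof (rule hcauchy_if_sq_dist_le)
  have sH: "s n \<in> H" for n using s S(1) by blast
  then show "s n \<in> H" for n .
  fix m n
  define a b where "a = f - s n" and "b = f - s m"
  have a: "a \<in> H" and b: "b \<in> H" unfolding a_def b_def using f sH by auto
  \<comment> \<open>parallelogram law for \<open>a, b\<close>, whose mean is \<open>f\<close> minus the midpoint of \<open>s n, s m \<in> S\<close>\<close>
  have "a + b = smult_fun 2 (f - smult_fun (1/2) (s n + s m))"
    unfolding a_def b_def by (auto simp: fun_eq_iff vec_eq_iff smult_fun_def field_simps)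
  then have "Re (ip (a + b) (a + b)) = 4 * Re (ip (f - smult_fun (1/2) (s n + s m)) (f - smult_fun (1/2) (s n + s m)))"
    using f sH by (simp add: ip_self_smult)
  moreover have "\<delta> \<le> Re (ip (f - smult_fun (1/2) (s n + s m)) (f - smult_fun (1/2) (s n + s m)))"
    using s S by (intro inf) blast
  moreover have "a - b = s m - s n" unfolding a_def b_def by simp
  then have "Re (ip (s m - s n) (s m - s n)) + Re (ip (a + b) (a + b)) = 2 * Re (ip a a) + 2 * Re (ip b b)"
    using parallelogram[OF a b] by simp
  moreover have "Re (ip a a) < \<delta> + 1 / (real n + 1)" "Re (ip b b) < \<delta> + 1 / (real m + 1)"
    unfolding a_def b_def by (fact approx)+
  ultimately show "Re (ip (s m - s n) (s m - s n)) \<le> 2 / (real n + 1) + 2 / (real m + 1)"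
    by linarith
qed

lemma minimizing_sequence_orthogonal:
  assumes S: "S \<subseteq> H" "\<And>s t. s \<in> S \<Longrightarrow> t \<in> S \<Longrightarrow> s + t \<in> S" "\<And>c s. s \<in> S \<Longrightarrow> smult_fun c s \<in> S"
    and f: "f \<in> H" and s: "\<And>n. s n \<in> S"
    and inf: "\<And>t. t \<in> S \<Longrightarrow> \<delta> \<le> Re (ip (f - t) (f - t))"
    and approx: "\<And>n. Re (ip (f - s n) (f - s n)) < \<delta> + 1 / (real n + 1)"
    and k: "k \<in> S"
  shows "(\<lambda>n. ip (f - s n) k) \<longlonglongrightarrow> 0"
proof -
  have kH: "k \<in> H" using k S(1) by blast
  have sH: "s n \<in> H" for n using s S(1) by blast
  have bound: "(cmod (ip (f - s n) k))^2 \<le> Re (ip k k) * inverse (real (Suc n))" for n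
  proof (cases "Re (ip k k) = 0")
    case True
    then show ?thesis using ip_self_Re_eq_0[OF kH] f sH by simp
  next
    case False
    define x t where "x = f - s n" and "t = ip x k / ip k k"
    have x: "x \<in> H" unfolding x_def using f sH by simp
    have "\<delta> \<le> Re (ip (f - (s n + smult_fun t k)) (f - (s n + smult_fun t k)))"
      using s k S by (intro inf) blast
    also have "f - (s n + smult_fun t k) = x - smult_fun t k"
      unfolding x_def by (simp add: algebra_simps)
    also have "Re (ip \<dots> \<dots>) = Re (ip x x) - (cmod (ip x k))^2 / Re (ip k k)"
      unfolding t_def by (rule ip_self_diff_projection[OF x kH False])
    finally have "(cmod (ip x k))^2 / Re (ip k k) < 1 / (real n + 1)"
      using approx[of n] unfolding x_def by simp
    moreover have "Re (ip k k) > 0" using ip_self_Re_nonneg[OF kH] False by linarith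
    ultimately show ?thesis
      unfolding x_def by (simp add: divide_less_eq inverse_eq_divide add.commute mult.commute)
  qed
  have "(\<lambda>n. (cmod (ip (f - s n) k))^2) \<longlonglongrightarrow> 0"
  proof (rule Lim_null_comparison)
    show "\<forall>\<^sub>F n in sequentially. norm ((cmod (ip (f - s n) k))^2) \<le> Re (ip k k) * inverse (real (Suc n))"
      using bound by (intro always_eventually allI) simp
    show "(\<lambda>n. Re (ip k k) * inverse (real (Suc n))) \<longlonglongrightarrow> 0"
      by (rule tendsto_mult_right_zero[OF LIMSEQ_inverse_real_of_nat])
  qed
  then have "(\<lambda>n. sqrt ((cmod (ip (f - s n) k))^2)) \<longlonglongrightarrow> sqrt 0"
    by (rule tendsto_real_sqrt)
  then show ?thesis by (simp add: tendsto_norm_zero_iff)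
qed

lemma minimizing_sequence_exists:
  assumes S: "S \<subseteq> H" "0 \<in> S" and f: "f \<in> H"
  obtains \<delta> s where "\<And>t. t \<in> S \<Longrightarrow> \<delta> \<le> Re (ip (f - t) (f - t))" "\<And>n. s n \<in> S"
    "\<And>n. Re (ip (f - s n) (f - s n)) < \<delta> + 1 / (real n + 1)"
proof -
  define D where "D = (\<lambda>t. Re (ip (f - t) (f - t))) ` S"
  have "bdd_below D" unfolding D_def bdd_below_def
    using f S(1) ip_self_Re_nonneg by (intro exI[of _ 0]) auto
  then have inf: "Inf D \<le> Re (ip (f - t) (f - t))" if "t \<in> S" for t
    unfolding D_def using that by (intro cInf_lower) auto
  have "\<exists>t\<in>S. Re (ip (f - t) (f - t)) < Inf D + 1 / (real n + 1)" for n
  proof -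
    have "D \<noteq> {}" unfolding D_def using S(2) by blast
    moreover have "Inf D < Inf D + 1 / (real n + 1)" by (simp add: add_pos_pos)
    ultimately obtain x where "x \<in> D" "x < Inf D + 1 / (real n + 1)" by (rule cInf_lessD[elim_format]) blast
    then show ?thesis unfolding D_def by blast
  qed
  then obtain s where "\<And>n. s n \<in> S" "\<And>n. Re (ip (f - s n) (f - s n)) < Inf D + 1 / (real n + 1)"
    by metis
  then show ?thesis using that inf by blast
qed

lemma orthogonal_projection:
  assumes S: "S \<subseteq> H" "0 \<in> S" "\<And>s t. s \<in> S \<Longrightarrow> t \<in> S \<Longrightarrow> s + t \<in> S"
      "\<And>c s. s \<in> S \<Longrightarrow> smult_fun c s \<in> S"
    and f: "f \<in> H"
  obtains s g where "\<And>n. s n \<in> S" "hcauchy ip s" "g \<in> H" "(\<lambda>n. hnorm ip (s n - g)) \<longlonglongrightarrow> 0"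
    "\<And>k. k \<in> S \<Longrightarrow> ip (f - g) k = 0"
proof -
  obtain \<delta> s where inf: "\<And>t. t \<in> S \<Longrightarrow> \<delta> \<le> Re (ip (f - t) (f - t))" and s: "\<And>n. s n \<in> S"
    and approx: "\<And>n. Re (ip (f - s n) (f - s n)) < \<delta> + 1 / (real n + 1)"
    using minimizing_sequence_exists[OF S(1,2) f] by blast
  have sH: "s n \<in> H" for n using s S(1) by blast
  have cauchy: "hcauchy ip s"
    using S(1,3,4) f s inf approx by (rule minimizing_sequence_hcauchy)
  then obtain g where g: "g \<in> H" and lim: "(\<lambda>n. hnorm ip (s n - g)) \<longlonglongrightarrow> 0"
    using complete sH by blast
  have "ip (f - g) k = 0" if k: "k \<in> S" for k
  proof -
    have kH: "k \<in> H" using k S(1) by blast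
    have "(\<lambda>n. ip (f - s n) k + (ip (s n) k - ip g k)) \<longlonglongrightarrow> 0 + (ip g k - ip g k)"
      using minimizing_sequence_orthogonal[OF S(1,3,4) f s inf approx k]
        ip_tendsto_left[OF sH g kH lim] by (intro tendsto_intros)
    moreover have "ip (f - s n) k + (ip (s n) k - ip g k) = ip (f - g) k" for n
      using f g sH kH by (simp add: ip_diff_left)
    ultimately show ?thesis by (simp add: LIMSEQ_const_iff)
  qed
  then show ?thesis using that s cauchy g lim by blast
qed

lemma kernel_span_dense:
  assumes f: "f \<in> H"
  obtains s where "\<And>n. s n \<in> kernel_span" "hcauchy ip s" "(\<lambda>n. hnorm ip (s n - f)) \<longlonglongrightarrow> 0"
proof -
  obtain s g where s: "\<And>n. s n \<in> kernel_span" "hcauchy ip s" and g: "g \<in> H"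
    and lim: "(\<lambda>n. hnorm ip (s n - g)) \<longlonglongrightarrow> 0" and orth: "\<And>k. k \<in> kernel_span \<Longrightarrow> ip (f - g) k = 0"
    using orthogonal_projection[OF kernel_span_subset kernel_span.zero kernel_span.add kernel_span.smult f]
    by blast
  have "f - g = 0"
    using f g orth kernel_span.kernel by (intro eq_0_if_orthogonal_kernels) auto
  then show ?thesis using that[of s] s lim by simp
qed

end

section \<open>Weighted composition operators\<close>

definition comp_op :: "complex^'n^'n \<Rightarrow> ('a \<Rightarrow> 'a) \<Rightarrow> ('a \<Rightarrow> complex^'n) \<Rightarrow> 'a \<Rightarrow> complex^'n" where
  "comp_op u \<phi> = (\<lambda>f z. u *v f (\<phi> z))"

lemma comp_op_apply: "comp_op u \<phi> f z = u *v f (\<phi> z)"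
  by (simp add: comp_op_def)

lemma comp_op_add: "comp_op u \<phi> (f + g) = comp_op u \<phi> f + comp_op u \<phi> g"
  by (simp add: comp_op_def fun_eq_iff matrix_vector_right_distrib)

lemma comp_op_diff: "comp_op u \<phi> (f - g) = comp_op u \<phi> f - comp_op u \<phi> g"
  by (simp add: comp_op_def fun_eq_iff matrix_vector_mult_diff_distrib)

lemma comp_op_smult: "comp_op u \<phi> (smult_fun c f) = smult_fun c (comp_op u \<phi> f)"
  by (simp add: comp_op_def fun_eq_iff smult_fun_def vector_scalar_commute)

lemma comp_op_0: "comp_op u \<phi> 0 = 0"
  by (simp add: comp_op_def fun_eq_iff)

context rkhs_space
begin

lemma hnorm_tendsto_imp_pointwise:
  assumes s: "\<And>n. s n \<in> H" and f: "f \<in> H" and lim: "(\<lambda>n. hnorm ip (s n - f)) \<longlonglongrightarrow> 0"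
  shows "(\<lambda>n. s n z) \<longlonglongrightarrow> f z"
proof (cases "z \<in> \<Omega>")
  case True
  show ?thesis
  proof (rule vec_tendstoI)
    fix i
    have "(\<lambda>n. ip (s n) (kernel_fun \<Omega> K z (axis i 1))) \<longlonglongrightarrow> ip f (kernel_fun \<Omega> K z (axis i 1))"
      using True by (intro ip_tendsto_left[OF s f] lim) simp
    then show "(\<lambda>n. s n z $ i) \<longlonglongrightarrow> f z $ i"
      using True s f by (simp add: reproducing vinner_axis)
  qed
qed (simp add: vanish_outside s f)

end

text \<open>The map \<open>\<phi>\<close> is total, so \<open>preserves\<close> also asks it to map the complement of \<open>\<Omega>\<close> into
  itself: the functions in \<open>H\<close> vanish there.\<close>

locale kernel_transport = rkhs_space +
  fixes \<phi> and u
  assumes preserves: "\<And>z. \<phi> z \<in> \<Omega> \<longleftrightarrow> z \<in> \<Omega>"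
    and onto: "\<And>w. w \<in> \<Omega> \<Longrightarrow> \<exists>w'\<in>\<Omega>. \<phi> w' = w"
    and intertwines: "\<And>z w. z \<in> \<Omega> \<Longrightarrow> w \<in> \<Omega> \<Longrightarrow> u ** K (\<phi> z) (\<phi> w) = K z w ** u"
    and isometry: "cadj u ** u = mat 1"
begin

lemma comp_op_kernel:
  assumes w: "w \<in> \<Omega>"
  shows "comp_op u \<phi> (kernel_fun \<Omega> K (\<phi> w) \<xi>) = kernel_fun \<Omega> K w (u *v \<xi>)"
proof
  fix z
  show "comp_op u \<phi> (kernel_fun \<Omega> K (\<phi> w) \<xi>) z = kernel_fun \<Omega> K w (u *v \<xi>) z"
  proof (cases "z \<in> \<Omega>")
    case True
    then have "u *v (K (\<phi> z) (\<phi> w) *v \<xi>) = K z w *v (u *v \<xi>)"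
      using intertwines[OF True w] by (simp add: matrix_vector_mul_assoc)
    then show ?thesis using True preserves[of z] by (simp add: comp_op_apply kernel_fun_def)
  qed (simp add: comp_op_apply kernel_fun_def preserves)
qed

lemma comp_op_kernel_span: "s \<in> kernel_span \<Longrightarrow> comp_op u \<phi> s \<in> kernel_span"
proof (induction rule: kernel_span.induct)
  case zero
  show ?case unfolding comp_op_0 by (rule kernel_span.zero)
next
  case (kernel w \<xi>)
  then obtain w' where "w' \<in> \<Omega>" "\<phi> w' = w" using onto by blast
  then show ?case using comp_op_kernel kernel_span.kernel by metis
next
  case (add s t)
  show ?case unfolding comp_op_add using add.IH by (rule kernel_span.add)
next
  case (smult s c)
  show ?case unfolding comp_op_smult using smult.IH by (rule kernel_span.smult)
qed

lemma comp_op_ip_kernel_span: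
  assumes f: "f \<in> H" "comp_op u \<phi> f \<in> H"
  shows "s \<in> kernel_span \<Longrightarrow> ip (comp_op u \<phi> f) (comp_op u \<phi> s) = ip f s"
  \<comment> \<open>with \<open>P\<close> left to unification, the induction would produce \<open>\<eta>\<close>-expanded goals\<close>
proof (induction rule: kernel_span.induct[where P = "\<lambda>s. ip (comp_op u \<phi> f) (comp_op u \<phi> s) = ip f s"])
  case zero
  show ?case unfolding comp_op_0 using f by simp
next
  case (kernel w \<xi>)
  then obtain w' where w': "w' \<in> \<Omega>" "\<phi> w' = w" using onto by blast
  then have "comp_op u \<phi> (kernel_fun \<Omega> K w \<xi>) = kernel_fun \<Omega> K w' (u *v \<xi>)"
    using comp_op_kernel by blast
  then have "ip (comp_op u \<phi> f) (comp_op u \<phi> (kernel_fun \<Omega> K w \<xi>)) = vinner (u *v f w) (u *v \<xi>)"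
    using reproducing[OF w'(1) f(2)] w'(2) by (simp add: comp_op_apply)
  also have "\<dots> = ip f (kernel_fun \<Omega> K w \<xi>)"
    using kernel f by (simp add: vinner_isometry[OF isometry] reproducing)
  finally show ?case .
next
  case (add s t)
  have "s \<in> H" "t \<in> H" "comp_op u \<phi> s \<in> H" "comp_op u \<phi> t \<in> H"
    using add(1,2) comp_op_kernel_span kernel_span_subset by blast+
  with add f show ?case by (simp add: comp_op_add ip_add_right)
next
  case (smult s c)
  have "s \<in> H" "comp_op u \<phi> s \<in> H"
    using smult(1) comp_op_kernel_span kernel_span_subset by blast+
  with smult f show ?case by (simp add: comp_op_smult ip_smult_right)
qed

lemma comp_op_limit:
  assumes f: "f \<in> H" and s: "\<And>n. s n \<in> kernel_span" and "hcauchy ip s"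
    and lim: "(\<lambda>n. hnorm ip (s n - f)) \<longlonglongrightarrow> 0"
  shows "comp_op u \<phi> f \<in> H" and "(\<lambda>n. hnorm ip (comp_op u \<phi> (s n) - comp_op u \<phi> f)) \<longlonglongrightarrow> 0"
proof -
  have sH: "s n \<in> H" and TsH: "comp_op u \<phi> (s n) \<in> H" for n
    using s comp_op_kernel_span kernel_span_subset by blast+
  have "hnorm ip (comp_op u \<phi> (s m) - comp_op u \<phi> (s n)) = hnorm ip (s m - s n)" for m n
  proof -
    have d: "s m - s n \<in> kernel_span"
      unfolding diff_eq_add_smult_fun using s by (intro kernel_span.add kernel_span.smult)
    then have "s m - s n \<in> H" "comp_op u \<phi> (s m - s n) \<in> H"
      using comp_op_kernel_span kernel_span_subset by blast+
    then have "ip (comp_op u \<phi> (s m - s n)) (comp_op u \<phi> (s m - s n)) = ip (s m - s n) (s m - s n)"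
      using d by (rule comp_op_ip_kernel_span)
    then show ?thesis unfolding hnorm_def comp_op_diff by simp
  qed
  then have "hcauchy ip (\<lambda>n. comp_op u \<phi> (s n))"
    using \<open>hcauchy ip s\<close> unfolding hcauchy_def by simp
  then have "\<exists>h\<in>H. (\<lambda>n. hnorm ip (comp_op u \<phi> (s n) - h)) \<longlonglongrightarrow> 0"
    using complete[of "\<lambda>n. comp_op u \<phi> (s n)"] TsH by blast
  then obtain h where h: "h \<in> H" and hlim: "(\<lambda>n. hnorm ip (comp_op u \<phi> (s n) - h)) \<longlonglongrightarrow> 0"
    by blast
  have "h = comp_op u \<phi> f"
  proof
    fix z
    have "(\<lambda>n. u *v s n (\<phi> z)) \<longlonglongrightarrow> h z"
      using hnorm_tendsto_imp_pointwise[OF TsH h hlim] by (simp add: comp_op_apply)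
    moreover have "(\<lambda>n. u *v s n (\<phi> z)) \<longlonglongrightarrow> u *v f (\<phi> z)"
      using hnorm_tendsto_imp_pointwise[OF sH f lim]
      by (rule bounded_linear.tendsto[OF matrix_vector_mul_bounded_linear])
    ultimately show "h z = comp_op u \<phi> f z" by (simp add: comp_op_apply LIMSEQ_unique)
  qed
  then show "comp_op u \<phi> f \<in> H" and "(\<lambda>n. hnorm ip (comp_op u \<phi> (s n) - comp_op u \<phi> f)) \<longlonglongrightarrow> 0"
    using h hlim by simp_all
qed

lemma comp_op_mem: "f \<in> H \<Longrightarrow> comp_op u \<phi> f \<in> H"
  using kernel_span_dense comp_op_limit(1) by metis

lemma comp_op_ip:
  assumes f: "f \<in> H" and g: "g \<in> H"
  shows "ip (comp_op u \<phi> f) (comp_op u \<phi> g) = ip f g"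
proof -
  obtain t where t: "\<And>n. t n \<in> kernel_span" "hcauchy ip t" and lim: "(\<lambda>n. hnorm ip (t n - g)) \<longlonglongrightarrow> 0"
    using kernel_span_dense[OF g] by blast
  have tH: "t n \<in> H" and TtH: "comp_op u \<phi> (t n) \<in> H" for n
    using t(1) comp_op_kernel_span kernel_span_subset by blast+
  have "(\<lambda>n. ip (comp_op u \<phi> f) (comp_op u \<phi> (t n))) \<longlonglongrightarrow> ip (comp_op u \<phi> f) (comp_op u \<phi> g)"
    using comp_op_limit[OF g t lim] TtH comp_op_mem[OF f] by (intro ip_tendsto_right)
  moreover have "(\<lambda>n. ip f (t n)) \<longlonglongrightarrow> ip f g"
    using tH g f lim by (rule ip_tendsto_right)
  moreover have "ip (comp_op u \<phi> f) (comp_op u \<phi> (t n)) = ip f (t n)" for n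
    using f comp_op_mem[OF f] t(1) by (rule comp_op_ip_kernel_span)
  ultimately show ?thesis by (simp add: LIMSEQ_unique)
qed

end

context rkhs_space
begin

lemma quasi_invariant_if_unitary_comp_op:
  assumes \<phi>: "\<And>z. z \<in> \<Omega> \<Longrightarrow> \<phi> z \<in> \<Omega>" and u: "unitary_mat u"
    and T: "unitary_op H ip (comp_op u \<phi>)" and z: "z \<in> \<Omega>" and w: "w \<in> \<Omega>"
  shows "K z w = u ** K (\<phi> z) (\<phi> w) ** cadj u"
proof -
  have kernel: "comp_op u \<phi> (kernel_fun \<Omega> K (\<phi> w) \<eta>) = kernel_fun \<Omega> K w (u *v \<eta>)" for \<eta>
  proof (rule eq_if_ip_eq)
    show "comp_op u \<phi> (kernel_fun \<Omega> K (\<phi> w) \<eta>) \<in> H"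
      using unitary_op_mem[OF T] \<phi>[OF w] by simp
    show "kernel_fun \<Omega> K w (u *v \<eta>) \<in> H" using w by simp
    fix g assume g: "g \<in> H"
    then obtain f where f: "f \<in> H" "comp_op u \<phi> f = g" using unitary_op_surj[OF T] by blast
    have "ip g (comp_op u \<phi> (kernel_fun \<Omega> K (\<phi> w) \<eta>)) = ip f (kernel_fun \<Omega> K (\<phi> w) \<eta>)"
      using unitary_op_ip[OF T f(1), of "kernel_fun \<Omega> K (\<phi> w) \<eta>"] \<phi>[OF w] f(2) by simp
    also have "\<dots> = vinner (u *v f (\<phi> w)) (u *v \<eta>)"
      using u \<phi>[OF w] f(1) by (simp add: reproducing vinner_isometry unitary_mat_def)
    also have "\<dots> = ip g (kernel_fun \<Omega> K w (u *v \<eta>))"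
      using reproducing[OF w g] f(2)[symmetric] by (simp add: comp_op_apply)
    finally show "ip g (comp_op u \<phi> (kernel_fun \<Omega> K (\<phi> w) \<eta>)) = ip g (kernel_fun \<Omega> K w (u *v \<eta>))" .
  qed
  have "(u ** K (\<phi> z) (\<phi> w)) *v \<eta> = (K z w ** u) *v \<eta>" for \<eta>
    using fun_cong[OF kernel[of \<eta>], of z] z \<phi>[OF z]
    by (simp add: comp_op_apply kernel_fun_def matrix_vector_mul_assoc)
  then have "u ** K (\<phi> z) (\<phi> w) = K z w ** u" by (simp add: matrix_eq)
  then have "u ** K (\<phi> z) (\<phi> w) ** cadj u = K z w ** (u ** cadj u)"
    by (simp add: matrix_mul_assoc)
  then show ?thesis using u by (simp add: unitary_mat_def)
qed

lemma kernel_transport_if_quasi_invariant: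
  assumes \<phi>: "\<And>z. \<phi> z \<in> \<Omega> \<longleftrightarrow> z \<in> \<Omega>" and \<psi>: "\<And>z. \<psi> z \<in> \<Omega> \<longleftrightarrow> z \<in> \<Omega>"
    and inverse: "\<And>z. \<phi> (\<psi> z) = z" and u: "unitary_mat u"
    and quasi: "\<And>z w. z \<in> \<Omega> \<Longrightarrow> w \<in> \<Omega> \<Longrightarrow> K z w = u ** K (\<phi> z) (\<phi> w) ** cadj u"
  shows "kernel_transport \<Omega> H ip K \<phi> u"
proof
  show "\<phi> z \<in> \<Omega> \<longleftrightarrow> z \<in> \<Omega>" for z by (fact \<phi>)
  show "\<exists>w'\<in>\<Omega>. \<phi> w' = w" if "w \<in> \<Omega>" for w using that \<psi> inverse by blast
  show uu: "cadj u ** u = mat 1" using u by (simp add: unitary_mat_def)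
  show "u ** K (\<phi> z) (\<phi> w) = K z w ** u" if "z \<in> \<Omega>" "w \<in> \<Omega>" for z w
  proof -
    have "K z w ** u = u ** K (\<phi> z) (\<phi> w) ** (cadj u ** u)"
      using quasi[OF that] by (simp add: matrix_mul_assoc)
    then show ?thesis using uu by simp
  qed
qed

lemma quasi_invariant_inverse:
  assumes \<psi>: "\<And>z. \<psi> z \<in> \<Omega> \<longleftrightarrow> z \<in> \<Omega>" and inverse: "\<And>z. \<phi> (\<psi> z) = z" and u: "unitary_mat u"
    and quasi: "\<And>z w. z \<in> \<Omega> \<Longrightarrow> w \<in> \<Omega> \<Longrightarrow> K z w = u ** K (\<phi> z) (\<phi> w) ** cadj u"
    and z: "z \<in> \<Omega>" and w: "w \<in> \<Omega>"
  shows "K z w = cadj u ** K (\<psi> z) (\<psi> w) ** cadj (cadj u)"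
proof -
  have "cadj u ** K (\<psi> z) (\<psi> w) ** u = (cadj u ** u) ** K z w ** (cadj u ** u)"
    using quasi[of "\<psi> z" "\<psi> w"] z w \<psi> inverse by (simp add: matrix_mul_assoc)
  then show ?thesis using u by (simp add: unitary_mat_def)
qed

lemma unitary_comp_op_if_quasi_invariant:
  assumes \<phi>: "\<And>z. \<phi> z \<in> \<Omega> \<longleftrightarrow> z \<in> \<Omega>" and \<psi>: "\<And>z. \<psi> z \<in> \<Omega> \<longleftrightarrow> z \<in> \<Omega>"
    and inverse: "\<And>z. \<phi> (\<psi> z) = z" "\<And>z. \<psi> (\<phi> z) = z"
    and u: "unitary_mat u"
    and quasi: "\<And>z w. z \<in> \<Omega> \<Longrightarrow> w \<in> \<Omega> \<Longrightarrow> K z w = u ** K (\<phi> z) (\<phi> w) ** cadj u"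
  shows "unitary_op H ip (comp_op u \<phi>)"
proof -
  interpret forward: kernel_transport \<Omega> H ip K \<phi> u
    using \<phi> \<psi> inverse(1) u quasi by (rule kernel_transport_if_quasi_invariant)
  interpret backward: kernel_transport \<Omega> H ip K \<psi> "cadj u"
    using \<psi> \<phi> inverse(2) unitary_mat_cadj[OF u] quasi_invariant_inverse[OF \<psi> inverse(1) u quasi]
    by (rule kernel_transport_if_quasi_invariant)
  show ?thesis unfolding unitary_op_def
  proof (intro conjI ballI allI)
    show "comp_op u \<phi> ` H = H"
    proof
      show "comp_op u \<phi> ` H \<subseteq> H" using forward.comp_op_mem by blast
      show "H \<subseteq> comp_op u \<phi> ` H"
      proof
        fix g assume g: "g \<in> H"
        have "g = comp_op u \<phi> (comp_op (cadj u) \<psi> g)"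
          using u by (simp add: comp_op_def matrix_vector_mul_assoc unitary_mat_def inverse(2))
        then show "g \<in> comp_op u \<phi> ` H" using backward.comp_op_mem[OF g] by blast
      qed
    qed
  qed (simp_all add: comp_op_add comp_op_smult forward.comp_op_ip)
qed

lemma unitary_comp_op_iff_quasi_invariant:
  assumes "\<And>z. \<phi> z \<in> \<Omega> \<longleftrightarrow> z \<in> \<Omega>" and "\<And>z. \<psi> z \<in> \<Omega> \<longleftrightarrow> z \<in> \<Omega>"
    and "\<And>z. \<phi> (\<psi> z) = z" "\<And>z. \<psi> (\<phi> z) = z" and "unitary_mat u"
  shows "unitary_op H ip (comp_op u \<phi>) \<longleftrightarrow>
    (\<forall>z\<in>\<Omega>. \<forall>w\<in>\<Omega>. K z w = u ** K (\<phi> z) (\<phi> w) ** cadj u)"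
  using assms quasi_invariant_if_unitary_comp_op unitary_comp_op_if_quasi_invariant by metis

lemma comp_op_intertwines_mult_op:
  assumes AB: "A ** B = mat 1" and T: "unitary_op H ip (comp_op u ((*v) B))" and g: "g \<in> H"
  shows "comp_op u ((*v) B) (lin_mult_op A j (hadj H ip (comp_op u ((*v) B)) g)) = mult_op j g"
proof
  fix z
  define h where "h = hadj H ip (comp_op u ((*v) B)) g"
  have "comp_op u ((*v) B) h = g" unfolding h_def using T g by (rule unitary_op_hadj)
  moreover have "comp_op u ((*v) B) (lin_mult_op A j h) z = z $ j *s comp_op u ((*v) B) h z"
    using AB by (simp add: comp_op_apply lin_mult_op_apply matrix_vector_mul_assoc vector_scalar_commute)
  ultimately show "comp_op u ((*v) B) (lin_mult_op A j (hadj H ip (comp_op u ((*v) B)) g)) z = mult_op j g z"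
    unfolding h_def by (simp add: mult_op_apply)
qed

end

section \<open>Homogeneity\<close>

definition const_fun :: "(complex^'d) set \<Rightarrow> complex^'n \<Rightarrow> complex^'d \<Rightarrow> complex^'n" where
  "const_fun \<Omega> \<xi> = restrict_fun \<Omega> (\<lambda>_. \<xi>)"

definition monomial_fun :: "(complex^'d) set \<Rightarrow> ('d \<Rightarrow> nat) \<Rightarrow> complex^'n \<Rightarrow> complex^'d \<Rightarrow> complex^'n" where
  "monomial_fun \<Omega> \<alpha> \<xi> = restrict_fun \<Omega> (\<lambda>z. monomial \<alpha> z *s \<xi>)"

lemma const_fun_apply: "z \<in> \<Omega> \<Longrightarrow> const_fun \<Omega> \<xi> z = \<xi>"
  by (simp add: const_fun_def restrict_fun_def)

lemma const_fun_add: "const_fun \<Omega> (\<xi> + \<eta>) = const_fun \<Omega> \<xi> + const_fun \<Omega> \<eta>"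
  by (auto simp: const_fun_def restrict_fun_def fun_eq_iff)

lemma const_fun_smult: "const_fun \<Omega> (c *s \<xi>) = smult_fun c (const_fun \<Omega> \<xi>)"
  by (auto simp: const_fun_def restrict_fun_def smult_fun_def fun_eq_iff)

lemma const_fun_0: "const_fun \<Omega> 0 = 0"
  by (auto simp: const_fun_def restrict_fun_def fun_eq_iff)

lemma monomial_fun_0: "monomial_fun \<Omega> (\<lambda>_. 0) \<xi> = const_fun \<Omega> \<xi>"
  by (simp add: monomial_fun_def const_fun_def)

lemma monomial_fun_remove_factor:
  "\<alpha> j > 0 \<Longrightarrow> monomial_fun \<Omega> \<alpha> \<xi> = mult_op j (monomial_fun \<Omega> (\<alpha>(j := \<alpha> j - 1)) \<xi>)"
  by (auto simp: monomial_fun_def restrict_fun_def mult_op_def fun_eq_iff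
      monomial_remove_factor[of \<alpha> j])

lemma restrict_fun_poly:
  assumes "\<And>z. p z = (\<Sum>\<alpha>\<in>S. monomial \<alpha> z *s c \<alpha>)"
  shows "restrict_fun \<Omega> p = (\<Sum>\<alpha>\<in>S. monomial_fun \<Omega> \<alpha> (c \<alpha>))"
  by (auto simp: fun_eq_iff sum_fun_apply monomial_fun_def restrict_fun_def assms)

text \<open>\<open>\<Gamma>\<close> is a unitary with \<open>\<Gamma> (k\<cdot>M) \<Gamma>\<^sup>* = M\<close> for \<open>k z = A z\<close>.\<close>

locale homogeneous_unitary = rkhs_space +
  fixes A B and \<Gamma>
  assumes inverse: "A ** B = mat 1" "B ** A = mat 1"
    and preserves: "\<And>z. A *v z \<in> \<Omega> \<longleftrightarrow> z \<in> \<Omega>"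
    and zero_in_domain: "0 \<in> \<Omega>"
    and dense: "polys_dense \<Omega> H ip"
    and bounded_mult: "\<forall>j. bounded_op_on H ip (mult_op j)"
    and normalized: "\<forall>z\<in>\<Omega>. K z 0 = mat 1"
    and unitary: "unitary_op H ip \<Gamma>"
    and intertwines: "\<forall>j. \<forall>g\<in>H. \<Gamma> (lin_mult_op A j (hadj H ip \<Gamma> g)) = mult_op j g"
begin

abbreviation adj where "adj \<equiv> hadj H ip \<Gamma>"

lemma inverse_preserves: "B *v z \<in> \<Omega> \<longleftrightarrow> z \<in> \<Omega>"
  using preserves[of "B *v z"] inverse(1) by (simp add: matrix_vector_mul_assoc)

lemma restrict_fun_poly_mem: "vec_poly p \<Longrightarrow> restrict_fun \<Omega> p \<in> H"
  using dense unfolding polys_dense_def by blast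

lemma monomial_fun_mem: "monomial_fun \<Omega> \<alpha> \<xi> \<in> H"
proof -
  have "vec_poly (\<lambda>z. monomial \<alpha> z *s \<xi>)"
    unfolding vec_poly_def by (intro exI[of _ "{\<alpha>}"] exI[of _ "\<lambda>_. \<xi>"]) simp
  then show ?thesis unfolding monomial_fun_def by (rule restrict_fun_poly_mem)
qed

lemma const_fun_eq_kernel: "const_fun \<Omega> \<xi> = kernel_fun \<Omega> K 0 \<xi>"
  using normalized by (auto simp: const_fun_def restrict_fun_def kernel_fun_def)

lemma const_fun_mem: "const_fun \<Omega> \<xi> \<in> H"
  unfolding const_fun_eq_kernel using zero_in_domain by simp

lemma ip_const_fun: "f \<in> H \<Longrightarrow> ip f (const_fun \<Omega> \<xi>) = vinner (f 0) \<xi>"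
  unfolding const_fun_eq_kernel using zero_in_domain by (rule reproducing)

lemma adj_mult_op: "g \<in> H \<Longrightarrow> adj (mult_op j g) = lin_mult_op A j (adj g)"
proof -
  assume g: "g \<in> H"
  have "mult_op i f \<in> H" if "f \<in> H" for i f
    using bounded_mult that unfolding bounded_op_on_def by blast
  then have "lin_mult_op A j (adj g) \<in> H"
    unfolding lin_mult_op_def using hadj_mem[OF unitary g] by (intro sum_mem ballI smult_mem)
  then show ?thesis
    using intertwines g hadj_unitary_op[OF unitary] by metis
qed

lemma adj_monomial_fun: "adj (monomial_fun \<Omega> \<alpha> \<xi>) z = monomial \<alpha> (A *v z) *s adj (const_fun \<Omega> \<xi>) z"
proof (induction "sum \<alpha> UNIV" arbitrary: \<alpha>)
  case 0
  then have "\<alpha> = (\<lambda>_. 0)" by (simp add: fun_eq_iff)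
  then show ?case by (simp add: monomial_fun_0)
next
  case (Suc n)
  then obtain j where j: "\<alpha> j > 0"
    by (metis neq0_conv sum.neutral_const sum.cong nat.distinct(1))
  define \<beta> where "\<beta> = \<alpha>(j := \<alpha> j - 1)"
  have "sum \<alpha> UNIV = \<alpha> j + sum \<alpha> (UNIV - {j})" "sum \<beta> UNIV = \<beta> j + sum \<beta> (UNIV - {j})"
    by (simp_all add: sum.remove)
  moreover have "sum \<beta> (UNIV - {j}) = sum \<alpha> (UNIV - {j})" unfolding \<beta>_def by (rule sum.cong) auto
  ultimately have "n = sum \<beta> UNIV" using Suc(2) j unfolding \<beta>_def by simp
  have "adj (monomial_fun \<Omega> \<alpha> \<xi>) z = adj (mult_op j (monomial_fun \<Omega> \<beta> \<xi>)) z"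
    unfolding \<beta>_def by (subst monomial_fun_remove_factor[of \<alpha> j, OF j]) (rule refl)
  also have "\<dots> = (A *v z) $ j *s adj (monomial_fun \<Omega> \<beta> \<xi>) z"
    by (simp add: adj_mult_op monomial_fun_mem lin_mult_op_apply)
  also have "\<dots> = (A *v z) $ j *s (monomial \<beta> (A *v z) *s adj (const_fun \<Omega> \<xi>) z)"
    using Suc(1) \<open>n = sum \<beta> UNIV\<close> by simp
  also have "\<dots> = monomial \<alpha> (A *v z) *s adj (const_fun \<Omega> \<xi>) z"
    using monomial_remove_factor[of \<alpha> j "A *v z", OF j] unfolding \<beta>_def by simp
  finally show ?case .
qed

lemma adj_poly:
  assumes "finite S" and p: "\<And>z. p z = (\<Sum>\<alpha>\<in>S. monomial \<alpha> z *s c \<alpha>)"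
  shows "adj (restrict_fun \<Omega> p) z = (\<Sum>\<alpha>\<in>S. monomial \<alpha> (A *v z) *s adj (const_fun \<Omega> (c \<alpha>)) z)"
proof -
  have "adj (restrict_fun \<Omega> p) = (\<Sum>\<alpha>\<in>S. adj (monomial_fun \<Omega> \<alpha> (c \<alpha>)))"
    unfolding restrict_fun_poly[OF p] using monomial_fun_mem by (intro hadj_sum[OF unitary]) blast
  then show ?thesis by (simp add: sum_fun_apply adj_monomial_fun)
qed

lemma adj_poly_at_0: "\<exists>L. \<forall>p. vec_poly p \<longrightarrow> adj (restrict_fun \<Omega> p) 0 = L *v p 0"
proof -
  define L where "L = matrix (\<lambda>\<zeta>. adj (const_fun \<Omega> \<zeta>) 0)"
  have "Vector_Spaces.linear (*s) (*s) (\<lambda>\<zeta>. adj (const_fun \<Omega> \<zeta>) 0)"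
  proof
    show "adj (const_fun \<Omega> (\<xi> + \<eta>)) 0 = adj (const_fun \<Omega> \<xi>) 0 + adj (const_fun \<Omega> \<eta>) 0" for \<xi> \<eta>
      by (simp add: const_fun_add hadj_add[OF unitary const_fun_mem const_fun_mem])
    show "adj (const_fun \<Omega> (c *s \<xi>)) 0 = c *s adj (const_fun \<Omega> \<xi>) 0" for c \<xi>
      unfolding const_fun_smult hadj_smult[OF unitary const_fun_mem] by (simp add: smult_fun_def)
  qed
  then have L: "L *v \<zeta> = adj (const_fun \<Omega> \<zeta>) 0" for \<zeta>
    unfolding L_def by (rule matrix_works)
  have "adj (restrict_fun \<Omega> p) 0 = L *v p 0" if "vec_poly p" for p
  proof -
    obtain S c where "finite S" and p: "\<And>z. p z = (\<Sum>\<alpha>\<in>S. monomial \<alpha> z *s c \<alpha>)"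
      using \<open>vec_poly p\<close> unfolding vec_poly_def by blast
    then show ?thesis by (simp add: adj_poly L[symmetric] vec.sum vector_scalar_commute)
  qed
  then show ?thesis by blast
qed

lemma unitary_const_fun: "\<exists>P. \<forall>\<xi>. \<Gamma> (const_fun \<Omega> \<xi>) = const_fun \<Omega> (P *v \<xi>)"
proof -
  obtain L where L: "\<And>p. vec_poly p \<Longrightarrow> adj (restrict_fun \<Omega> p) 0 = L *v p 0"
    using adj_poly_at_0 by blast
  have "\<Gamma> (const_fun \<Omega> \<xi>) - const_fun \<Omega> (cadj L *v \<xi>) = 0" for \<xi>
  proof (rule eq_0_if_orthogonal_polys[OF dense])
    show "\<Gamma> (const_fun \<Omega> \<xi>) - const_fun \<Omega> (cadj L *v \<xi>) \<in> H"
      using unitary_op_mem[OF unitary] const_fun_mem by simp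
    show "ip (\<Gamma> (const_fun \<Omega> \<xi>) - const_fun \<Omega> (cadj L *v \<xi>)) (restrict_fun \<Omega> p) = 0"
      if p: "vec_poly p" for p
    proof -
      define q where "q = restrict_fun \<Omega> p"
      have q: "q \<in> H" unfolding q_def using p by (rule restrict_fun_poly_mem)
      have "ip (const_fun \<Omega> (cadj L *v \<xi>)) q = cnj (vinner (q 0) (cadj L *v \<xi>))"
        using ip_cnj[OF q const_fun_mem] ip_const_fun[OF q] by simp
      also have "\<dots> = cnj (vinner (adj q 0) \<xi>)"
        using zero_in_domain L[OF p] by (simp add: q_def restrict_fun_def vinner_matrix_vector_left)
      also have "\<dots> = ip (\<Gamma> (const_fun \<Omega> \<xi>)) q"
        using ip_hadj_right[OF unitary const_fun_mem q] ip_cnj[OF hadj_mem[OF unitary q] const_fun_mem]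
          ip_const_fun[OF hadj_mem[OF unitary q]] by simp
      finally show ?thesis
        using unitary_op_mem[OF unitary] const_fun_mem q unfolding q_def[symmetric]
        by (simp add: ip_diff_left)
    qed
  qed
  then show ?thesis by auto
qed

lemma adj_const_fun: "\<exists>Q. \<forall>\<eta>. adj (const_fun \<Omega> \<eta>) = const_fun \<Omega> (Q *v \<eta>)"
proof -
  obtain P where P: "\<And>\<xi>. \<Gamma> (const_fun \<Omega> \<xi>) = const_fun \<Omega> (P *v \<xi>)"
    using unitary_const_fun by blast
  have "\<xi> = 0" if "P *v \<xi> = 0" for \<xi>
  proof -
    have "\<Gamma> (const_fun \<Omega> \<xi>) = \<Gamma> 0"
      using that P unitary_op_0[OF unitary] by (simp add: const_fun_0)
    then have "const_fun \<Omega> \<xi> = 0"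
      by (metis hadj_unitary_op[OF unitary] const_fun_mem zero_mem)
    then show ?thesis using const_fun_apply[OF zero_in_domain, of \<xi>] by simp
  qed
  then obtain Q where QP: "Q ** P = mat 1" using matrix_left_invertible_ker by blast
  then have PQ: "P ** Q = mat 1" by (rule matrix_left_right_inverse[THEN iffD1])
  have "adj (const_fun \<Omega> \<eta>) = const_fun \<Omega> (Q *v \<eta>)" for \<eta>
    using hadj_unitary_op[OF unitary const_fun_mem, of "Q *v \<eta>"] P PQ
    by (simp add: matrix_vector_mul_assoc)
  then show ?thesis by blast
qed

context
  fixes Q
  assumes adj_const_fun_Q: "\<And>\<eta>. adj (const_fun \<Omega> \<eta>) = const_fun \<Omega> (Q *v \<eta>)"
begin

lemma adj_poly_apply:
  assumes "vec_poly p" and z: "z \<in> \<Omega>"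
  shows "adj (restrict_fun \<Omega> p) z = Q *v p (A *v z)"
proof -
  obtain S c where "finite S" and p: "\<And>z. p z = (\<Sum>\<alpha>\<in>S. monomial \<alpha> z *s c \<alpha>)"
    using \<open>vec_poly p\<close> unfolding vec_poly_def by blast
  then show ?thesis
    by (simp add: adj_poly adj_const_fun_Q const_fun_apply[OF z] vec.sum vector_scalar_commute)
qed

lemma unitary_kernel_fun:
  assumes w: "w \<in> \<Omega>"
  shows "\<Gamma> (kernel_fun \<Omega> K w \<eta>) = kernel_fun \<Omega> K (A *v w) (cadj Q *v \<eta>)"
proof -
  have Aw: "A *v w \<in> \<Omega>" using preserves w by blast
  have "\<Gamma> (kernel_fun \<Omega> K w \<eta>) - kernel_fun \<Omega> K (A *v w) (cadj Q *v \<eta>) = 0"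
  proof (rule eq_0_if_orthogonal_polys[OF dense])
    show "\<Gamma> (kernel_fun \<Omega> K w \<eta>) - kernel_fun \<Omega> K (A *v w) (cadj Q *v \<eta>) \<in> H"
      using unitary_op_mem[OF unitary] w Aw by simp
    show "ip (\<Gamma> (kernel_fun \<Omega> K w \<eta>) - kernel_fun \<Omega> K (A *v w) (cadj Q *v \<eta>)) (restrict_fun \<Omega> p) = 0"
      if p: "vec_poly p" for p
    proof -
      define q where "q = restrict_fun \<Omega> p"
      have q: "q \<in> H" unfolding q_def using p by (rule restrict_fun_poly_mem)
      have "ip q (\<Gamma> (kernel_fun \<Omega> K w \<eta>)) = vinner (adj q w) \<eta>"
        using ip_hadj_left[OF unitary q, of "kernel_fun \<Omega> K w \<eta>"] reproducing[OF w hadj_mem[OF unitary q]] w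
        by simp
      also have "\<dots> = vinner (q (A *v w)) (cadj Q *v \<eta>)"
        using adj_poly_apply[OF p w] Aw by (simp add: q_def restrict_fun_def vinner_matrix_vector_left)
      also have "\<dots> = ip q (kernel_fun \<Omega> K (A *v w) (cadj Q *v \<eta>))"
        using reproducing[OF Aw q] by simp
      finally have "ip q (\<Gamma> (kernel_fun \<Omega> K w \<eta>) - kernel_fun \<Omega> K (A *v w) (cadj Q *v \<eta>)) = 0"
        using unitary_op_mem[OF unitary] w Aw q by (simp add: ip_diff_right)
      then show ?thesis
        using unitary_op_mem[OF unitary] w Aw q ip_cnj unfolding q_def[symmetric]
        by (metis complex_cnj_zero diff_mem kernel_mem)
    qed
  qed
  then show ?thesis by simp
qed

lemma adj_apply:
  assumes f: "f \<in> H" and w: "w \<in> \<Omega>"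
  shows "adj f w = Q *v f (A *v w)"
proof (rule vinner_eqI)
  fix \<eta>
  have Aw: "A *v w \<in> \<Omega>" using preserves w by blast
  have "vinner (adj f w) \<eta> = ip f (\<Gamma> (kernel_fun \<Omega> K w \<eta>))"
    using reproducing[OF w hadj_mem[OF unitary f]] ip_hadj_left[OF unitary f] w by simp
  also have "\<dots> = vinner (f (A *v w)) (cadj Q *v \<eta>)"
    unfolding unitary_kernel_fun[OF w] using reproducing[OF Aw f] .
  also have "\<dots> = vinner (Q *v f (A *v w)) \<eta>"
    by (simp add: vinner_matrix_vector_left)
  finally show "vinner (adj f w) \<eta> = vinner (Q *v f (A *v w)) \<eta>" .
qed

lemma unitary_mat_Q: "unitary_mat Q"
proof (rule unitary_matI)
  have "vinner (Q *v \<xi>) (Q *v \<eta>) = vinner \<xi> \<eta>" for \<xi> \<eta>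
  proof -
    have "ip (adj (const_fun \<Omega> \<xi>)) (adj (const_fun \<Omega> \<eta>)) = ip (const_fun \<Omega> \<xi>) (const_fun \<Omega> \<eta>)"
      using hadj_ip[OF unitary const_fun_mem const_fun_mem] .
    then show ?thesis
      unfolding adj_const_fun_Q using const_fun_mem
      by (simp add: ip_const_fun const_fun_apply[OF zero_in_domain])
  qed
  then have "(cadj Q ** Q) *v \<xi> = mat 1 *v \<xi>" for \<xi>
    by (intro vinner_eqI) (simp add: vinner_matrix_vector_left matrix_vector_mul_assoc[symmetric])
  then show "cadj Q ** Q = mat 1" by (simp add: matrix_eq)
qed

lemma unitary_eq_comp_op:
  assumes f: "f \<in> H"
  shows "\<Gamma> f = comp_op (cadj Q) ((*v) B) f"
proof
  fix z
  show "\<Gamma> f z = comp_op (cadj Q) ((*v) B) f z"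
  proof (cases "z \<in> \<Omega>")
    case True
    then have "f (B *v z) = Q *v \<Gamma> f z"
      using adj_apply[OF unitary_op_mem[OF unitary f], of "B *v z"] hadj_unitary_op[OF unitary f]
        inverse inverse_preserves by (simp add: matrix_vector_mul_assoc)
    then show ?thesis
      using unitary_mat_Q
      by (simp add: comp_op_apply matrix_vector_mul_assoc unitary_mat_def)
  next
    case False
    then show ?thesis
      using vanish_outside[OF f] vanish_outside[OF unitary_op_mem[OF unitary f]] inverse_preserves
      by (simp add: comp_op_apply)
  qed
qed

end

lemma unitary_comp_op_if_homogeneous: "\<exists>u. unitary_mat u \<and> unitary_op H ip (comp_op u ((*v) B))"
proof -
  obtain Q where Q: "\<And>\<eta>. adj (const_fun \<Omega> \<eta>) = const_fun \<Omega> (Q *v \<eta>)"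
    using adj_const_fun by blast
  have "unitary_op H ip (comp_op (cadj Q) ((*v) B))"
    using unitary_op_cong[OF unitary] unitary_eq_comp_op[OF Q] by metis
  then show ?thesis
    using unitary_mat_cadj[OF unitary_mat_Q[OF Q]] by blast
qed

end

context rkhs_space
begin

lemma homogeneous_iff_unitary_comp_op:
  assumes A: "A \<in> lin_aut \<Omega>" and "open \<Omega>" and "0 \<in> \<Omega>" and "polys_dense \<Omega> H ip"
    and "\<forall>j. bounded_op_on H ip (mult_op j)" and "\<forall>z\<in>\<Omega>. K z 0 = mat 1"
  shows "(\<exists>\<Gamma>. unitary_op H ip \<Gamma> \<and> (\<forall>j. \<forall>g\<in>H. \<Gamma> (lin_mult_op A j (hadj H ip \<Gamma> g)) = mult_op j g))
    \<longleftrightarrow> (\<exists>u. unitary_mat u \<and> unitary_op H ip (comp_op u ((*v) (matrix_inv A))))"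
proof -
  have "\<Omega> \<noteq> {}" using \<open>0 \<in> \<Omega>\<close> by blast
  note inverse = lin_aut_inverse[OF A \<open>open \<Omega>\<close> this]
  show ?thesis
  proof
    assume "\<exists>\<Gamma>. unitary_op H ip \<Gamma> \<and> (\<forall>j. \<forall>g\<in>H. \<Gamma> (lin_mult_op A j (hadj H ip \<Gamma> g)) = mult_op j g)"
    then obtain \<Gamma> where "unitary_op H ip \<Gamma>" "\<forall>j. \<forall>g\<in>H. \<Gamma> (lin_mult_op A j (hadj H ip \<Gamma> g)) = mult_op j g"
      by blast
    then interpret homogeneous_unitary \<Omega> H ip K A "matrix_inv A" \<Gamma>
      using assms inverse by unfold_locales auto
    show "\<exists>u. unitary_mat u \<and> unitary_op H ip (comp_op u ((*v) (matrix_inv A)))"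
      by (rule unitary_comp_op_if_homogeneous)
  qed (use comp_op_intertwines_mult_op[OF inverse(1)] in blast)
qed

lemma lin_aut_unitary_comp_op_iff_quasi_invariant:
  assumes A: "A \<in> lin_aut \<Omega>" and "open \<Omega>" and "\<Omega> \<noteq> {}" and "unitary_mat u"
  shows "unitary_op H ip (comp_op u ((*v) (matrix_inv A)))
    \<longleftrightarrow> (\<forall>z\<in>\<Omega>. \<forall>w\<in>\<Omega>. K z w = u ** K (matrix_inv A *v z) (matrix_inv A *v w) ** cadj u)"
  using lin_aut_inverse[OF assms(1-3)] assms(4)
  by (intro unitary_comp_op_iff_quasi_invariant[where \<psi> = "(*v) A"]) (simp_all add: matrix_vector_mul_assoc)

end

lemma ex_unitary_comp_op_iff:
  "(\<exists>c. (\<forall>A\<in>S. unitary_mat (c A)) \<and> (\<forall>A\<in>S. unitary_op H ip (\<lambda>f z. c A *v f (matrix_inv A *v z))))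
    \<longleftrightarrow> (\<forall>A\<in>S. \<exists>u. unitary_mat u \<and> unitary_op H ip (comp_op u ((*v) (matrix_inv A))))"
  unfolding comp_op_def
proof
  assume "\<forall>A\<in>S. \<exists>u. unitary_mat u \<and> unitary_op H ip (\<lambda>f z. u *v f (matrix_inv A *v z))"
  from bchoice[OF this] show "\<exists>c. (\<forall>A\<in>S. unitary_mat (c A)) \<and>
      (\<forall>A\<in>S. unitary_op H ip (\<lambda>f z. c A *v f (matrix_inv A *v z)))" by blast
qed blast

lemma ex_constant_multiplier_iff:
  assumes "z\<^sub>0 \<in> \<Omega>"
  shows "(\<exists>c. (\<forall>A\<in>S. \<forall>z\<in>\<Omega>. unitary_mat (c A z)) \<and> (\<forall>A\<in>S. \<forall>z\<in>\<Omega>. \<forall>w\<in>\<Omega>. c A z = c A w) \<and>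
             (\<forall>A\<in>S. \<forall>z\<in>\<Omega>. \<forall>w\<in>\<Omega>.
                K z w = c A z ** K (matrix_inv A *v z) (matrix_inv A *v w) ** cadj (c A w)))
    \<longleftrightarrow> (\<forall>A\<in>S. \<exists>u. unitary_mat u \<and>
             (\<forall>z\<in>\<Omega>. \<forall>w\<in>\<Omega>. K z w = u ** K (matrix_inv A *v z) (matrix_inv A *v w) ** cadj u))"
    (is "(\<exists>c. ?const c) \<longleftrightarrow> (\<forall>A\<in>S. \<exists>u. ?quasi A u)")
proof
  assume "\<exists>c. ?const c"
  then obtain c where "?const c" by blast
  then have "?quasi A (c A z\<^sub>0)" if "A \<in> S" for A
    using that assms by metis
  then show "\<forall>A\<in>S. \<exists>u. ?quasi A u" by blast
next
  assume "\<forall>A\<in>S. \<exists>u. ?quasi A u"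
  from bchoice[OF this] obtain c where "\<forall>A\<in>S. ?quasi A (c A)" by blast
  then have "?const (\<lambda>A z. c A)" by simp
  then show "\<exists>c. ?const c" by (rule exI[of _ "\<lambda>A z. c A"])
qed

theorem lemma2p2:
  fixes \<Omega> :: "(complex^'d) set"
    and H :: "(complex^'d \<Rightarrow> complex^'n) set"
    and ip :: "(complex^'d \<Rightarrow> complex^'n) \<Rightarrow> (complex^'d \<Rightarrow> complex^'n) \<Rightarrow> complex"
    and K :: "complex^'d \<Rightarrow> complex^'d \<Rightarrow> complex^'n^'n"
  assumes dom: "irreducible_bsd \<Omega>"
    and zero: "0 \<in> \<Omega>"
    and rkhs: "rkhs_holo \<Omega> H ip K"
    and dense: "polys_dense \<Omega> H ip"
    and bdd: "\<forall>j. bounded_op_on H ip (mult_op j)"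
    and norm0: "\<forall>z\<in>\<Omega>. K z 0 = mat 1"
  shows "((\<forall>A\<in>lin_aut \<Omega>. \<exists>\<Gamma>. unitary_op H ip \<Gamma> \<and>
              (\<forall>j. \<forall>g\<in>H. \<Gamma> (lin_mult_op A j (hadj H ip \<Gamma> g)) = mult_op j g))
         \<longleftrightarrow>
         (\<exists>c :: complex^'d^'d \<Rightarrow> complex^'d \<Rightarrow> complex^'n^'n.
             (\<forall>A\<in>lin_aut \<Omega>. \<forall>z\<in>\<Omega>. unitary_mat (c A z)) \<and>
             (\<forall>A\<in>lin_aut \<Omega>. \<forall>z\<in>\<Omega>. \<forall>w\<in>\<Omega>. c A z = c A w) \<and>
             (\<forall>A\<in>lin_aut \<Omega>. \<forall>z\<in>\<Omega>. \<forall>w\<in>\<Omega>.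
                K z w = c A z ** K (matrix_inv A *v z) (matrix_inv A *v w) ** cadj (c A w))))
       \<and>
       ((\<exists>c :: complex^'d^'d \<Rightarrow> complex^'d \<Rightarrow> complex^'n^'n.
             (\<forall>A\<in>lin_aut \<Omega>. \<forall>z\<in>\<Omega>. unitary_mat (c A z)) \<and>
             (\<forall>A\<in>lin_aut \<Omega>. \<forall>z\<in>\<Omega>. \<forall>w\<in>\<Omega>. c A z = c A w) \<and>
             (\<forall>A\<in>lin_aut \<Omega>. \<forall>z\<in>\<Omega>. \<forall>w\<in>\<Omega>.
                K z w = c A z ** K (matrix_inv A *v z) (matrix_inv A *v w) ** cadj (c A w)))
         \<longleftrightarrow>
         (\<exists>c :: complex^'d^'d \<Rightarrow> complex^'n^'n.
             (\<forall>A\<in>lin_aut \<Omega>. unitary_mat (c A)) \<and>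
             (\<forall>A\<in>lin_aut \<Omega>. unitary_op H ip (\<lambda>f z. c A *v f (matrix_inv A *v z)))))"
proof -
  interpret rkhs: rkhs_space \<Omega> H ip K by (rule rkhs_space.intro) (fact rkhs)
  have "open \<Omega>" and "\<Omega> \<noteq> {}"
    using dom by (auto simp: irreducible_bsd_def bounded_symmetric_domain_def bounded_domain_def)
  have quasi_invariant:
    "(\<exists>u. unitary_mat u \<and> unitary_op H ip (comp_op u ((*v) (matrix_inv A))))
      \<longleftrightarrow> (\<exists>u. unitary_mat u \<and>
            (\<forall>z\<in>\<Omega>. \<forall>w\<in>\<Omega>. K z w = u ** K (matrix_inv A *v z) (matrix_inv A *v w) ** cadj u))"
    if "A \<in> lin_aut \<Omega>" for A
    using rkhs.lin_aut_unitary_comp_op_iff_quasi_invariant[OF that \<open>open \<Omega>\<close> \<open>\<Omega> \<noteq> {}\<close>] by blast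
  show ?thesis
    unfolding ex_constant_multiplier_iff[OF zero] ex_unitary_comp_op_iff
    by (simp add: rkhs.homogeneous_iff_unitary_comp_op[OF _ \<open>open \<Omega>\<close> zero dense bdd norm0]
        quasi_invariant cong: ball_cong)
qed

end
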